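(* Let $n\ge 3$ be an integer and let $X_1,X_2,\ldots,X_n$ be independent, identically distributed positive random variables whose common distribution $F$ has a density $f$ that is positive and continuous on $(0,\infty)$. Let $X_{(1)}\le X_{(2)}\le\cdots\le X_{(n)}$ be the order statistics and $\overline{X}_n=\frac1n\sum_{i=1}^n X_i$ the sample mean. Let $U:\mathbf{A}\to\mathbb{R}$ be a feasible definite function of h-degree $1$, and define $$Z_n=U\big(X_{(1)}-\overline{X}_n,\;X_{(2)}-\overline{X}_n,\;\ldots,\;X_{(n)}-\overline{X}_n\big).$$ Then the random variables $\overline{X}_n$ and $V_n:=Z_n/\overline{X}_n$ are independent if and only if $F$ is a gamma distribution.
   Context: The set $\mathbf{A}\subset\mathbb{R}^n$ is $$\mathbf{A}=\Big\{\lambda=(\lambda_1,\ldots,\lambda_n):\ \lambda_1\le\lambda_2\le\cdots\le\lambda_n,\ \sum_{i=1}^n\lambda_i=0\Big\}.$$ For $p>0$, a function $U:\mathbf{A}\to\mathbb{R}$ is called a feasible definite function of h-degree $p$ if: (i) $U$ is nonnegative and continuous on $\mathbf{A}$; (ii) $U(\lambda)=0$ if and only if $\lambda=(0,\ldots,0)$; (iii) $U(s\lambda)=s^pU(\lambda)$ for all $s>0$ and all $\lambda\in\mathbf{A}$. A distribution $F$ is a gamma distribution if, for some $a>0$ and $b>0$, it is absolutely continuous with density $\frac{1}{\Gamma(a)b^a}x^{a-1}e^{-x/b}$ for $x>0$ and $0$ for $x\le 0$. *)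

theory Defs
  imports "HOL-Probability.Probability"
begin

text \<open>
  A vector of \<open>\<real>\<^sup>n\<close> is represented by a function on \<open>{1..n}\<close> that is \<^const>\<open>undefined\<close> outside
  that set. On \<^term>\<open>{1..n} \<rightarrow>\<^sub>E (UNIV :: real set)\<close> the topology of the function type
  (pointwise convergence) is the Euclidean topology of \<open>\<real>\<^sup>n\<close>.
\<close>

definition ordered_zero_sum :: "nat \<Rightarrow> (nat \<Rightarrow> real) set" where
  "ordered_zero_sum n =
     {l \<in> {1..n} \<rightarrow>\<^sub>E UNIV. mono_on {1..n} l \<and> (\<Sum>i=1..n. l i) = 0}"

definition feasible_definite :: "nat \<Rightarrow> real \<Rightarrow> ((nat \<Rightarrow> real) \<Rightarrow> real) \<Rightarrow> bool" where
  "feasible_definite n p U \<longleftrightarrow>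
     p > 0 \<and>
     (\<forall>l\<in>ordered_zero_sum n. U l \<ge> 0) \<and>
     continuous_on (ordered_zero_sum n) U \<and>
     (\<forall>l\<in>ordered_zero_sum n. U l = 0 \<longleftrightarrow> (\<forall>i\<in>{1..n}. l i = 0)) \<and>
     (\<forall>s>0. \<forall>l\<in>ordered_zero_sum n. U (\<lambda>i\<in>{1..n}. s * l i) = s powr p * U l)"

definition gamma_density :: "real \<Rightarrow> real \<Rightarrow> real \<Rightarrow> real" where
  "gamma_density a b x =
     (if x > 0 then 1 / (Gamma a * b powr a) * x powr (a - 1) * exp (- x / b) else 0)"

definition gamma_distribution :: "real measure \<Rightarrow> bool" where
  "gamma_distribution F \<longleftrightarrow>
     (\<exists>a>0. \<exists>b>0. F = density lborel (\<lambda>x. ennreal (gamma_density a b x)))"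

definition sample_mean :: "nat \<Rightarrow> (nat \<Rightarrow> 'a \<Rightarrow> real) \<Rightarrow> 'a \<Rightarrow> real" where
  "sample_mean n X \<omega> = (\<Sum>i=1..n. X i \<omega>) / real n"

text \<open>Order statistics are indexed from 1, list positions from 0.\<close>

definition order_statistic :: "nat \<Rightarrow> (nat \<Rightarrow> 'a \<Rightarrow> real) \<Rightarrow> nat \<Rightarrow> 'a \<Rightarrow> real" where
  "order_statistic n X k \<omega> = sort (map (\<lambda>i. X i \<omega>) [1..<Suc n]) ! (k - 1)"

definition dispersion_statistic ::
  "nat \<Rightarrow> ((nat \<Rightarrow> real) \<Rightarrow> real) \<Rightarrow> (nat \<Rightarrow> 'a \<Rightarrow> real) \<Rightarrow> 'a \<Rightarrow> real" where
  "dispersion_statistic n U X \<omega> =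
     U (\<lambda>k\<in>{1..n}. order_statistic n X k \<omega> - sample_mean n X \<omega>)"

end

theory Submission
  imports Defs
begin

text \<open>
  Both directions rest on the coordinates \<open>x\<^sub>i = m * (1 + w\<^sub>i)\<close> with \<open>\<Sum>i. w\<^sub>i = 0\<close>. Here \<open>m\<close> is the
  sample mean, and since the dispersion statistic ignores translations and is homogeneous of degree
  1, its quotient by the mean is a function of the shape \<open>w\<close> alone. The Jacobian is proportional to
  \<open>m ^ (n - 1)\<close>, so the joint law of the two statistics becomes an iterated integral, first over the
  shapes and then over the means (\<open>emeasure_mean_dispersion\<close>).

  For a gamma sample the product of the densities at \<open>m * (1 + w\<^sub>i)\<close> is a function of \<open>m\<close> times a
  function of \<open>w\<close>, because \<open>\<Sum>i. 1 + w\<^sub>i = n\<close> removes \<open>w\<close> from the exponential factor. Hence the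
  joint law is a product (\<open>indep_if_gamma\<close>).

  Conversely, let \<open>J\<^sub>e(m)\<close> be the integral of \<open>\<Prod>i. f (m * (1 + w\<^sub>i))\<close> over the shapes \<open>w\<close> of
  dispersion at most \<open>e\<close>. Independence says that \<open>J\<^sub>e(m) / J\<^sub>e'(m)\<close> is the same for all \<open>m\<close>. As
  \<open>e'\<close> tends to 0 these shapes shrink to the origin, by the definiteness of \<open>U\<close>, and
  \<open>J\<^sub>e'(m)\<close> becomes proportional to \<open>f m ^ n\<close>; so \<open>J\<^sub>e(m) = H(e) * f m ^ n\<close>, a mean value
  property of \<open>f\<close> (\<open>avg_proportional\<close>).

  A kernel \<open>\<phi> x = exp (\<alpha> + k * ln x + \<beta> * x)\<close> has the same property, with a constant \<open>G\<^sub>k(e)\<close>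
  that depends only on \<open>k\<close>. If \<open>\<phi>\<close> touches \<open>f\<close> from above at an interior point, comparing the
  averages there gives \<open>H(e) < G\<^sub>k(e)\<close> for all small \<open>e\<close>; touching from below gives
  \<open>H(e) > G\<^sub>k(e)\<close>. For a given \<open>k\<close> at most one of the two can happen, whatever \<open>\<alpha>\<close> and \<open>\<beta>\<close> are, so
  \<open>ln f - k * ln\<close> is convex or concave. Comparison with touching functions thus replaces the second
  derivative of \<open>ln f\<close>, which need not exist. Looking at one chord shows that the function is
  convex for large \<open>k\<close> and concave for small \<open>k\<close>; at the transition it is both, hence affine
  (\<open>ln_affine_if_convex_or_concave\<close>). So \<open>f\<close> is a kernel \<open>\<phi>\<close> (\<open>gamma_kernel_if_proportional\<close>), and
  its integrability forces \<open>k > - 1\<close> and \<open>\<beta> < 0\<close> (\<open>gamma_kernel_integrable_imp\<close>), which makes it a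
  gamma density.
\<close>

section \<open>Coordinates centred at the sample mean\<close>

lemma nn_integral_PiM_affine:
  fixes H :: "('i \<Rightarrow> real) \<Rightarrow> ennreal"
  assumes "finite I" and "H \<in> borel_measurable (PiM I (\<lambda>_. lborel))" and "s \<noteq> 0"
  shows "(\<integral>\<^sup>+x. H x \<partial>PiM I (\<lambda>_. lborel)) =
    ennreal (\<bar>s\<bar> ^ card I) * (\<integral>\<^sup>+x. H (\<lambda>i\<in>I. t + s * x i) \<partial>PiM I (\<lambda>_. lborel))"
  using assms(1,2)
proof (induction I arbitrary: H)
  case empty
  then show ?case
    by (simp add: PiM_empty nn_integral_count_space_finite)
next
  case (insert i I)
  interpret product_sigma_finite "\<lambda>_. lborel :: real measure" by standard
  note [simp] = insert.hyps
  note [measurable] = insert.prems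
  have [measurable]: "(\<lambda>x. \<lambda>j\<in>J. t + s * x j) \<in> PiM J (\<lambda>_. lborel) \<rightarrow>\<^sub>M PiM J (\<lambda>_. lborel)" for J
    by measurable
  have aff: "(\<integral>\<^sup>+y. H (x(i := y)) \<partial>lborel) = ennreal \<bar>s\<bar> * (\<integral>\<^sup>+y. H (x(i := t + s * y)) \<partial>lborel)"
    if "x \<in> space (PiM I (\<lambda>_. lborel))" for x
  proof (rule nn_integral_real_affine[OF _ \<open>s \<noteq> 0\<close>])
    have "(\<lambda>y. H (x(i := y))) \<in> borel_measurable lborel"
      using that by measurable
    then show "(\<lambda>y. H (x(i := y))) \<in> borel_measurable borel" by simp
  qed
  have shifted: "(\<lambda>x. \<integral>\<^sup>+y. H ((\<lambda>j\<in>I. t + s * x j)(i := t + s * y)) \<partial>lborel)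
      \<in> borel_measurable (PiM I (\<lambda>_. lborel))"
    by measurable
  have "(\<integral>\<^sup>+x. H x \<partial>PiM (insert i I) (\<lambda>_. lborel)) =
      (\<integral>\<^sup>+x. \<integral>\<^sup>+y. H (x(i := y)) \<partial>lborel \<partial>PiM I (\<lambda>_. lborel))"
    by (rule product_nn_integral_insert) auto
  also have "\<dots> = ennreal (\<bar>s\<bar> ^ card I) *
      (\<integral>\<^sup>+x. \<integral>\<^sup>+y. H ((\<lambda>j\<in>I. t + s * x j)(i := y)) \<partial>lborel \<partial>PiM I (\<lambda>_. lborel))"
    by (rule insert.IH) measurable
  also have "\<dots> = ennreal (\<bar>s\<bar> ^ card I) * (\<integral>\<^sup>+x. ennreal \<bar>s\<bar> *
      (\<integral>\<^sup>+y. H ((\<lambda>j\<in>I. t + s * x j)(i := t + s * y)) \<partial>lborel) \<partial>PiM I (\<lambda>_. lborel))"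
    by (intro arg_cong2[where f = "(*)"] refl nn_integral_cong aff)
       (auto simp: space_PiM)
  also have "\<dots> = ennreal (\<bar>s\<bar> ^ card (insert i I)) * (\<integral>\<^sup>+x.
      (\<integral>\<^sup>+y. H ((\<lambda>j\<in>I. t + s * x j)(i := t + s * y)) \<partial>lborel) \<partial>PiM I (\<lambda>_. lborel))"
    by (subst nn_integral_cmult[OF shifted]) (simp add: ennreal_mult mult_ac)
  also have "(\<integral>\<^sup>+x. (\<integral>\<^sup>+y. H ((\<lambda>j\<in>I. t + s * x j)(i := t + s * y)) \<partial>lborel) \<partial>PiM I (\<lambda>_. lborel)) =
     (\<integral>\<^sup>+x. (\<integral>\<^sup>+y. H (\<lambda>j\<in>insert i I. t + s * (x(i := y)) j) \<partial>lborel) \<partial>PiM I (\<lambda>_. lborel))"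
    by (intro nn_integral_cong arg_cong[where f = H]) (auto simp: fun_eq_iff)
  also have "\<dots> = (\<integral>\<^sup>+x. H (\<lambda>j\<in>insert i I. t + s * x j) \<partial>PiM (insert i I) (\<lambda>_. lborel))"
    by (rule product_nn_integral_insert[symmetric]) auto
  finally show ?case .
qed

text \<open>
  A point of the hyperplane of vectors with sum 0 is represented by its first \<open>n - 1\<close> coordinates;
  the last one is recovered here.
\<close>

definition close_sum :: "nat \<Rightarrow> (nat \<Rightarrow> real) \<Rightarrow> nat \<Rightarrow> real" where
  "close_sum n w = w(n := - (\<Sum>i=1..<n. w i))"

definition sample_of_shape :: "nat \<Rightarrow> real \<Rightarrow> (nat \<Rightarrow> real) \<Rightarrow> nat \<Rightarrow> real" where
  "sample_of_shape n m w = (\<lambda>i\<in>{1..n}. m * (1 + close_sum n w i))"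

lemma atLeastAtMost_eq_insert: "n \<ge> 1 \<Longrightarrow> {1..n} = insert n {1..<n::nat}"
  by auto

lemma sum_close_sum: "n \<ge> 1 \<Longrightarrow> (\<Sum>i=1..n. close_sum n w i) = 0"
  by (subst atLeastAtMost_eq_insert) (simp_all add: close_sum_def)

lemma sum_sample_of_shape: "n \<ge> 1 \<Longrightarrow> (\<Sum>i=1..n. sample_of_shape n m w i) = real n * m"
  using sum_close_sum[of n w]
  by (simp add: sample_of_shape_def sum.distrib sum_distrib_left[symmetric])

lemma measurable_close_sum [measurable]:
  "(\<lambda>w. close_sum n w i) \<in> borel_measurable (PiM {1..<n} (\<lambda>_. lborel))" if "i \<in> {1..n}"
proof (cases "i = n")
  case False
  with that have "i \<in> {1..<n}" by auto
  then have "(\<lambda>w. w i) \<in> borel_measurable (PiM {1..<n} (\<lambda>_. lborel))" by measurable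
  with False show ?thesis by (simp add: close_sum_def)
qed (auto simp: close_sum_def)

text \<open>
  For fixed first coordinates the last coordinate is \<open>n\<close> times the mean up to a translation, which
  gives the factor \<open>n\<close>; for a fixed mean the remaining \<open>n - 1\<close> coordinates are rescaled by the
  affine map \<open>w \<mapsto> m + m * w\<close>, which gives the factor \<open>m ^ (n - 1)\<close>.
\<close>

lemma nn_integral_mean_and_shape:
  fixes H :: "(nat \<Rightarrow> real) \<Rightarrow> ennreal"
  assumes n: "n \<ge> 1" and H [measurable]: "H \<in> borel_measurable (PiM {1..n} (\<lambda>_. lborel))"
    and zero: "\<And>x. (\<Sum>i=1..n. x i) \<le> 0 \<Longrightarrow> H x = 0"
  shows "(\<integral>\<^sup>+x. H x \<partial>PiM {1..n} (\<lambda>_. lborel)) =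
    (\<integral>\<^sup>+m. ennreal (real n * m ^ (n - 1)) * indicator {0<..} m *
       (\<integral>\<^sup>+w. H (sample_of_shape n m w) \<partial>PiM {1..<n} (\<lambda>_. lborel)) \<partial>lborel)"
proof -
  interpret product_sigma_finite "\<lambda>_. lborel :: real measure" by standard
  let ?N = "PiM {1..<n} (\<lambda>_. lborel :: real measure)"
  interpret N: sigma_finite_measure ?N by (rule sigma_finite) auto
  interpret P: pair_sigma_finite ?N lborel by standard
  have ins: "insert n {1..<n} = {1..n}" using n by auto
  have upd [measurable]: "(\<lambda>(x, y). x(n := y)) \<in> ?N \<Otimes>\<^sub>M borel \<rightarrow>\<^sub>M PiM {1..n} (\<lambda>_. lborel)"
    using measurable_add_dim[of n "{1..<n}" "\<lambda>_. lborel :: real measure"] unfolding ins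
    by (simp cong: measurable_cong_sets)
  have sumN: "(\<lambda>x. \<Sum>i=1..<n. x i) \<in> borel_measurable ?N"
    by measurable
  have aff: "(\<lambda>p. real n * snd p - (\<Sum>i=1..<n. fst p i)) \<in> ?N \<Otimes>\<^sub>M borel \<rightarrow>\<^sub>M borel"
    using measurable_compose[OF measurable_fst sumN] by measurable
  have [measurable]: "(\<lambda>p. (fst p)(n := real n * snd p - (\<Sum>i=1..<n. fst p i))) \<in> ?N \<Otimes>\<^sub>M borel \<rightarrow>\<^sub>M PiM {1..n} (\<lambda>_. lborel)"
    using measurable_compose[OF measurable_Pair[OF measurable_fst aff] upd] by simp
  have [measurable]: "(\<lambda>(x, m). H (x(n := real n * m - (\<Sum>i=1..<n. x i)))) \<in> borel_measurable (?N \<Otimes>\<^sub>M borel)"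
    unfolding case_prod_beta by measurable
  have "(\<integral>\<^sup>+x. H x \<partial>PiM {1..n} (\<lambda>_. lborel)) = (\<integral>\<^sup>+x. \<integral>\<^sup>+y. H (x(n := y)) \<partial>lborel \<partial>?N)"
    using product_nn_integral_insert[of "{1..<n}" n H, unfolded ins] H by simp
  also have "\<dots> = (\<integral>\<^sup>+x. ennreal (real n) *
      (\<integral>\<^sup>+m. H (x(n := real n * m - (\<Sum>i=1..<n. x i))) \<partial>lborel) \<partial>?N)"
  proof (rule nn_integral_cong)
    fix x assume x: "x \<in> space ?N"
    have "(\<lambda>y. H (x(n := y))) \<in> borel_measurable borel"
      using measurable_compose[OF measurable_Pair1'[OF x] upd] H by (auto intro: measurable_compose)
    from nn_integral_real_affine[OF this, of "real n" "- (\<Sum>i=1..<n. x i)"] n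
    show "(\<integral>\<^sup>+y. H (x(n := y)) \<partial>lborel) = ennreal (real n) *
      (\<integral>\<^sup>+m. H (x(n := real n * m - (\<Sum>i=1..<n. x i))) \<partial>lborel)"
      by simp
  qed
  also have "\<dots> = ennreal (real n) *
      (\<integral>\<^sup>+x. \<integral>\<^sup>+m. H (x(n := real n * m - (\<Sum>i=1..<n. x i))) \<partial>lborel \<partial>?N)"
    by (rule nn_integral_cmult) measurable
  also have "\<dots> = ennreal (real n) *
      (\<integral>\<^sup>+m. \<integral>\<^sup>+x. H (x(n := real n * m - (\<Sum>i=1..<n. x i))) \<partial>?N \<partial>lborel)"
    by (intro arg_cong2[where f = "(*)"] refl P.Fubini'[symmetric]) measurable
  also have "\<dots> = (\<integral>\<^sup>+m. ennreal (real n) *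
      (\<integral>\<^sup>+x. H (x(n := real n * m - (\<Sum>i=1..<n. x i))) \<partial>?N) \<partial>lborel)"
    by (rule nn_integral_cmult[symmetric]) measurable
  also have "\<dots> = (\<integral>\<^sup>+m. ennreal (real n * m ^ (n - 1)) * indicator {0<..} m *
       (\<integral>\<^sup>+w. H (sample_of_shape n m w) \<partial>?N) \<partial>lborel)"
  proof (rule nn_integral_cong)
    fix m :: real
    let ?x = "\<lambda>x. x(n := real n * m - (\<Sum>i=1..<n. x i))"
    have sum_x: "(\<Sum>i=1..n. (?x x) i) = real n * m" for x
      using n by (subst atLeastAtMost_eq_insert) simp_all
    show "ennreal (real n) * (\<integral>\<^sup>+x. H (?x x) \<partial>?N) =
        ennreal (real n * m ^ (n - 1)) * indicator {0<..} m * (\<integral>\<^sup>+w. H (sample_of_shape n m w) \<partial>?N)"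
    proof (cases "m > 0")
      case False
      then have "H (?x x) = 0" for x
        using zero[of "?x x"] sum_x by (simp add: mult_nonneg_nonpos)
      with False show ?thesis by simp
    next
      case True
      have *: "?x (\<lambda>i\<in>{1..<n}. m + m * w i) = sample_of_shape n m w" for w
        using n True
        by (auto simp: fun_eq_iff sample_of_shape_def close_sum_def sum.distrib algebra_simps of_nat_diff
            sum_distrib_left[symmetric])
      have "(\<lambda>x. H (?x x)) \<in> borel_measurable ?N"
        by measurable
      from nn_integral_PiM_affine[OF _ this, of m m] True
      have "(\<integral>\<^sup>+x. H (?x x) \<partial>?N) = ennreal (m ^ (n - 1)) * (\<integral>\<^sup>+w. H (?x (\<lambda>i\<in>{1..<n}. m + m * w i)) \<partial>?N)"
        by simp
      with True show ?thesis
        unfolding * by (simp add: ennreal_mult mult_ac)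
    qed
  qed
  finally show ?thesis .
qed

section \<open>Order statistics and the dispersion statistic\<close>

text \<open>
  With the coordinate functions as random variables, the statistics become functions on \<open>\<real>\<^sup>n\<close>.
\<close>

abbreviation (input) coord :: "nat \<Rightarrow> (nat \<Rightarrow> real) \<Rightarrow> real" where
  "coord \<equiv> \<lambda>i x. x i"

lemma sort_map_mono:
  fixes f :: "'a::linorder \<Rightarrow> 'b::linorder"
  assumes "mono f"
  shows "sort (map f xs) = map f (sort xs)"
proof (rule properties_for_sort)
  show "sorted (map f (sort xs))"
    using assms by (simp add: sorted_map mono_def sorted_wrt_mono_rel[OF _ sorted_sort])
qed simp

lemma sorted_nth_le_iff:
  fixes xs :: "'a::linorder list"
  assumes "sorted xs" and "j < length xs"
  shows "xs ! j \<le> t \<longleftrightarrow> Suc j \<le> length (filter (\<lambda>x. x \<le> t) xs)"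
proof
  assume *: "xs ! j \<le> t"
  have "x \<le> t" if "x \<in> set (take (Suc j) xs)" for x
  proof -
    obtain i where "i \<le> j" "x = xs ! i"
      using \<open>x \<in> set _\<close> assms(2) by (auto simp: in_set_conv_nth less_Suc_eq_le)
    then show ?thesis
      using sorted_nth_mono[OF assms(1), of i j] assms(2) * by simp
  qed
  then have "filter (\<lambda>x. x \<le> t) (take (Suc j) xs) = take (Suc j) xs"
    by (simp add: filter_id_conv)
  then have "length (filter (\<lambda>x. x \<le> t) (take (Suc j) xs @ drop (Suc j) xs)) \<ge> Suc j"
    using assms(2) by (simp only: filter_append) simp
  then show "Suc j \<le> length (filter (\<lambda>x. x \<le> t) xs)" by simp
next
  assume *: "Suc j \<le> length (filter (\<lambda>x. x \<le> t) xs)"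
  show "xs ! j \<le> t"
  proof (rule ccontr)
    assume "\<not> xs ! j \<le> t"
    have "\<not> x \<le> t" if x: "x \<in> set (drop j xs)" for x
    proof -
      obtain i where "j + i < length xs" "x = xs ! (j + i)"
        using x assms(2) by (auto simp: in_set_conv_nth add.commute less_diff_conv)
      then show ?thesis
        using sorted_nth_mono[OF assms(1), of j "j + i"] \<open>\<not> xs ! j \<le> t\<close> by simp
    qed
    then have "filter (\<lambda>x. x \<le> t) (drop j xs) = []"
      by (simp add: filter_empty_conv)
    then have "length (filter (\<lambda>x. x \<le> t) (take j xs @ drop j xs)) \<le> j"
      using length_filter_le[of "\<lambda>x. x \<le> t" "take j xs"] by (simp only: filter_append) simp
    with * show False by simp
  qed
qed

text \<open>
  Counting turns a statement about sorted lists into one about a sum of indicators, from which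
  measurability follows.
\<close>

lemma order_statistic_le_iff:
  assumes "k \<in> {1..n}"
  shows "order_statistic n X k \<omega> \<le> t \<longleftrightarrow> k \<le> (\<Sum>i=1..n. if X i \<omega> \<le> t then 1 else 0)"
proof -
  have "order_statistic n X k \<omega> \<le> t \<longleftrightarrow>
      k \<le> length (filter (\<lambda>x. x \<le> t) (map (\<lambda>i. X i \<omega>) [1..<Suc n]))"
    using assms unfolding order_statistic_def
    by (subst sorted_nth_le_iff) (auto simp: filter_sort)
  also have "length (filter (\<lambda>x. x \<le> t) (map (\<lambda>i. X i \<omega>) [1..<Suc n])) =
      (\<Sum>i\<leftarrow>[1..<Suc n]. if X i \<omega> \<le> t then 1 else 0)"
    by (simp add: filter_map o_def sum_list_map_filter'[symmetric] sum_list_triv)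
  also have "\<dots> = (\<Sum>i=1..n. if X i \<omega> \<le> t then 1 else 0)"
    by (simp add: sum_list_distinct_conv_sum_set atLeastLessThanSuc_atLeastAtMost del: upt_Suc)
  finally show ?thesis .
qed

lemma borel_measurable_order_statistic:
  assumes "k \<in> {1..n}" and [measurable]: "\<And>i. i \<in> {1..n} \<Longrightarrow> X i \<in> borel_measurable M"
  shows "order_statistic n X k \<in> borel_measurable M"
proof (rule borel_measurable_iff_le[THEN iffD2], intro allI)
  fix t
  have "(\<lambda>\<omega>. (\<Sum>i=1..n. if X i \<omega> \<le> t then 1 else 0 :: nat)) \<in> measurable M (count_space UNIV)"
    by measurable
  then have "{\<omega> \<in> space M. k \<le> (\<Sum>i=1..n. if X i \<omega> \<le> t then 1 else 0)} \<in> sets M"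
    by measurable
  then show "{\<omega> \<in> space M. order_statistic n X k \<omega> \<le> t} \<in> sets M"
    using order_statistic_le_iff[OF assms(1), of X] by simp
qed

lemma sum_order_statistic:
  "(\<Sum>k=1..n. g (order_statistic n X k \<omega>)) = (\<Sum>i=1..n. g (X i \<omega>))"
proof -
  let ?xs = "map (\<lambda>i. X i \<omega>) [1..<Suc n]"
  have "(\<Sum>k=1..n. g (order_statistic n X k \<omega>)) = (\<Sum>k<n. g (sort ?xs ! k))"
    unfolding order_statistic_def
    by (rule sum.reindex_bij_witness[of _ Suc "\<lambda>k. k - 1"]) auto
  also have "\<dots> = sum_list (map g (sort ?xs))"
    by (simp add: sum_list_sum_nth atLeast0LessThan del: upt_Suc)
  also have "\<dots> = sum_list (map g ?xs)"
    by (metis mset_map mset_sort sum_mset_sum_list)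
  also have "\<dots> = (\<Sum>i=1..n. g (X i \<omega>))"
    by (simp add: o_def sum_list_distinct_conv_sum_set atLeastLessThanSuc_atLeastAtMost del: upt_Suc)
  finally show ?thesis .
qed

lemma order_statistic_affine:
  assumes "k \<in> {1..n}" and "b \<ge> 0"
  shows "order_statistic n (\<lambda>i \<omega>. a + b * X i \<omega>) k \<omega> = a + b * order_statistic n X k \<omega>"
proof -
  have "mono (\<lambda>x. a + b * x)"
    using assms(2) by (auto intro!: monoI mult_left_mono)
  have len: "k - 1 < length (sort (map (\<lambda>i. X i \<omega>) [1..<Suc n]))"
    using assms(1) by auto
  from sort_map_mono[OF \<open>mono _\<close>, of "map (\<lambda>i. X i \<omega>) [1..<Suc n]"] show ?thesis
    using nth_map[OF len, of "\<lambda>x. a + b * x"] unfolding order_statistic_def by (simp add: o_def del: upt_Suc)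
qed

lemma order_statistic_cong:
  assumes "\<And>i. i \<in> {1..n} \<Longrightarrow> X i \<omega> = Y i \<omega>'"
  shows "order_statistic n X k \<omega> = order_statistic n Y k \<omega>'"
proof -
  have "map (\<lambda>i. X i \<omega>) [1..<Suc n] = map (\<lambda>i. Y i \<omega>') [1..<Suc n]"
    using assms by (intro map_cong) auto
  then show ?thesis unfolding order_statistic_def by (rule arg_cong)
qed

lemma sample_mean_cong:
  assumes "\<And>i. i \<in> {1..n} \<Longrightarrow> X i \<omega> = Y i \<omega>'"
  shows "sample_mean n X \<omega> = sample_mean n Y \<omega>'"
  using assms by (simp add: sample_mean_def)

lemma dispersion_statistic_cong:
  assumes "\<And>i. i \<in> {1..n} \<Longrightarrow> X i \<omega> = Y i \<omega>'"
  shows "dispersion_statistic n U X \<omega> = dispersion_statistic n U Y \<omega>'"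
  using order_statistic_cong[of n X \<omega> Y \<omega>', OF assms] sample_mean_cong[of n X \<omega> Y \<omega>', OF assms]
  by (simp add: dispersion_statistic_def)

lemma centred_order_statistics_in_ordered_zero_sum:
  assumes "n \<ge> 1"
  shows "(\<lambda>k\<in>{1..n}. order_statistic n X k \<omega> - sample_mean n X \<omega>) \<in> ordered_zero_sum n"
proof -
  have "mono_on {1..n} (\<lambda>k. order_statistic n X k \<omega>)"
    unfolding order_statistic_def
    by (intro mono_onI sorted_nth_mono) auto
  then show ?thesis
    using assms sum_order_statistic[of "\<lambda>x. x" n X \<omega>]
    by (auto simp: ordered_zero_sum_def mono_on_def sum_subtractf sample_mean_def)
qed

text \<open>
  \<open>U\<close> is controlled only on \<open>ordered_zero_sum n\<close>, where it is continuous. The centred order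
  statistics always lie in that set.
\<close>

lemma borel_measurable_dispersion_statistic:
  assumes "n \<ge> 1" and "feasible_definite n p U"
    and [measurable]: "\<And>i. i \<in> {1..n} \<Longrightarrow> X i \<in> borel_measurable M"
  shows "dispersion_statistic n U X \<in> borel_measurable M"
proof -
  let ?l = "\<lambda>\<omega>. \<lambda>k\<in>{1..n}. order_statistic n X k \<omega> - sample_mean n X \<omega>"
  have [measurable]: "sample_mean n X \<in> borel_measurable M"
    unfolding sample_mean_def by measurable
  have "?l \<in> borel_measurable M"
  proof (rule measurable_coordinatewise_then_product)
    fix k
    show "(\<lambda>\<omega>. ?l \<omega> k) \<in> borel_measurable M"
    proof (cases "k \<in> {1..n}")
      case True
      note borel_measurable_order_statistic[OF True, of X M, measurable]
      show ?thesis using True by simp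
    next
      case False
      then have "(\<lambda>\<omega>. ?l \<omega> k) = (\<lambda>_. undefined)" by auto
      then show ?thesis by (metis borel_measurable_const)
    qed
  qed
  then have "?l \<in> M \<rightarrow>\<^sub>M restrict_space borel (ordered_zero_sum n)"
    using centred_order_statistics_in_ordered_zero_sum[OF assms(1)]
    by (intro measurable_restrict_space2) auto
  moreover have "U \<in> borel_measurable (restrict_space borel (ordered_zero_sum n))"
    using assms(2) by (intro borel_measurable_continuous_on_restrict) (simp add: feasible_definite_def)
  ultimately show ?thesis
    unfolding dispersion_statistic_def by (rule measurable_compose)
qed

lemma feasible_definite_homogeneous:
  "U (\<lambda>i\<in>{1..n}. s * l i) = s powr p * U l"
  if "feasible_definite n p U" and "s > 0" and "l \<in> ordered_zero_sum n"
  using that by (simp add: feasible_definite_def)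

lemma dispersion_statistic_affine:
  assumes "n \<ge> 1" and "feasible_definite n p U" and "b > 0"
  shows "dispersion_statistic n U (\<lambda>i \<omega>. a + b * X i \<omega>) \<omega> = b powr p * dispersion_statistic n U X \<omega>"
proof -
  have mean: "sample_mean n (\<lambda>i \<omega>. a + b * X i \<omega>) \<omega> = a + b * sample_mean n X \<omega>"
    using assms(1) by (simp add: sample_mean_def sum.distrib sum_distrib_left[symmetric] add_divide_distrib)
  let ?l = "\<lambda>k\<in>{1..n}. order_statistic n X k \<omega> - sample_mean n X \<omega>"
  have "(\<lambda>k\<in>{1..n}. order_statistic n (\<lambda>i \<omega>. a + b * X i \<omega>) k \<omega> - sample_mean n (\<lambda>i \<omega>. a + b * X i \<omega>) \<omega>) =
      (\<lambda>k\<in>{1..n}. b * ?l k)"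
    using assms(3) by (auto simp: fun_eq_iff order_statistic_affine mean right_diff_distrib)
  moreover have "U (\<lambda>k\<in>{1..n}. b * ?l k) = b powr p * U ?l"
    using assms(2,3) centred_order_statistics_in_ordered_zero_sum[OF assms(1)]
    by (rule feasible_definite_homogeneous)
  ultimately show ?thesis by (simp add: dispersion_statistic_def)
qed

text \<open>
  The coordinates outside \<open>{1..n}\<close> are fixed to \<^const>\<open>undefined\<close>, so the set is a closed subset of a
  product of compact sets over all of \<open>\<nat>\<close>, and Tychonoff's theorem applies.
\<close>

lemma compact_ordered_zero_sum_sphere:
  "compact {l \<in> ordered_zero_sum n. (\<Sum>i=1..n. \<bar>l i\<bar>) = 1}" (is "compact ?K")
proof -
  let ?S = "\<lambda>i::nat. if i \<in> {1..n} then {-1..1::real} else {undefined}"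
  have "compactin (product_topology (\<lambda>i. euclidean) UNIV) (PiE UNIV ?S)"
    unfolding compactin_PiE by auto
  then have "compact (PiE UNIV ?S)"
    by (simp add: euclidean_product_topology)
  moreover have "closed (\<Inter>(i, j)\<in>{(i, j). i \<in> {1..n} \<and> j \<in> {1..n} \<and> i \<le> j}. {l :: nat \<Rightarrow> real. l i \<le> l j})"
    by (intro closed_INT ballI) (auto intro!: closed_Collect_le)
  moreover have "closed {l :: nat \<Rightarrow> real. (\<Sum>i=1..n. l i) = 0}"
    by (intro closed_Collect_eq continuous_intros) auto
  moreover have "closed {l :: nat \<Rightarrow> real. (\<Sum>i=1..n. \<bar>l i\<bar>) = 1}"
    by (intro closed_Collect_eq continuous_intros) auto
  ultimately have "compact (PiE UNIV ?S \<inter>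
      (\<Inter>(i, j)\<in>{(i, j). i \<in> {1..n} \<and> j \<in> {1..n} \<and> i \<le> j}. {l :: nat \<Rightarrow> real. l i \<le> l j}) \<inter>
      {l :: nat \<Rightarrow> real. (\<Sum>i=1..n. l i) = 0} \<inter> {l :: nat \<Rightarrow> real. (\<Sum>i=1..n. \<bar>l i\<bar>) = 1})"
    by (intro compact_Int_closed)
  also have "\<dots> = ?K"
  proof (intro equalityI subsetI)
    fix l assume l: "l \<in> ?K"
    have "\<bar>l i\<bar> \<le> 1" if "i \<in> {1..n}" for i
      using l that member_le_sum[of i "{1..n}" "\<lambda>i. \<bar>l i\<bar>"] by auto
    with l show "l \<in> PiE UNIV ?S \<inter>
      (\<Inter>(i, j)\<in>{(i, j). i \<in> {1..n} \<and> j \<in> {1..n} \<and> i \<le> j}. {l :: nat \<Rightarrow> real. l i \<le> l j}) \<inter>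
      {l :: nat \<Rightarrow> real. (\<Sum>i=1..n. l i) = 0} \<inter> {l :: nat \<Rightarrow> real. (\<Sum>i=1..n. \<bar>l i\<bar>) = 1}"
      by (auto simp: ordered_zero_sum_def mono_on_def PiE_iff extensional_def abs_le_iff minus_le_iff)
  qed (auto simp: ordered_zero_sum_def mono_on_def PiE_iff extensional_def split: if_splits)
  finally show ?thesis .
qed

text \<open>
  On the compact unit sphere of the sum norm the continuous positive function \<open>U\<close> lies between two
  positive constants; homogeneity extends the bounds. So \<open>U\<close> is comparable with a norm.
\<close>

lemma feasible_definite_bounds:
  assumes "n \<ge> 1" and "feasible_definite n 1 U"
  obtains c C where "c > 0" "C > 0"
    "\<forall>l\<in>ordered_zero_sum n. c * (\<Sum>i=1..n. \<bar>l i\<bar>) \<le> U l \<and> U l \<le> C * (\<Sum>i=1..n. \<bar>l i\<bar>)"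
proof -
  let ?N = "\<lambda>l. \<Sum>i=1..n. \<bar>l i :: real\<bar>"
  define K where "K = {l \<in> ordered_zero_sum n. ?N l = 1}"
  have K: "compact K" unfolding K_def by (rule compact_ordered_zero_sum_sphere)
  have cont: "continuous_on K U"
    using assms(2) by (auto simp: feasible_definite_def K_def intro: continuous_on_subset)
  have pos: "U l > 0" if "l \<in> K" for l
  proof -
    have "\<exists>i\<in>{1..n}. l i \<noteq> 0"
    proof (rule ccontr)
      assume "\<not> ?thesis"
      then have "?N l = 0" by simp
      with that show False by (simp add: K_def)
    qed
    moreover have "U l \<ge> 0" "U l = 0 \<longleftrightarrow> (\<forall>i\<in>{1..n}. l i = 0)"
      using assms(2) that by (auto simp: feasible_definite_def K_def)
    ultimately show ?thesis by (metis less_eq_real_def)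
  qed
  have "\<exists>c C. c > 0 \<and> C > 0 \<and> (\<forall>l\<in>K. c \<le> U l \<and> U l \<le> C)"
  proof (cases "K = {}")
    case False
    from continuous_attains_inf[OF K False cont] obtain a where "a \<in> K" "\<forall>l\<in>K. U a \<le> U l" by blast
    moreover from continuous_attains_sup[OF K False cont] obtain b where "b \<in> K" "\<forall>l\<in>K. U l \<le> U b" by blast
    ultimately show ?thesis using pos by blast
  qed (auto intro: exI[of _ 1])
  then obtain c C where c: "c > 0" "C > 0" "\<And>l. l \<in> K \<Longrightarrow> c \<le> U l" "\<And>l. l \<in> K \<Longrightarrow> U l \<le> C" by blast
  have *: "c * ?N l \<le> U l \<and> U l \<le> C * ?N l" if l: "l \<in> ordered_zero_sum n" for l
  proof (cases "?N l = 0")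
    case True
    then have "\<forall>i\<in>{1..n}. l i = 0" by (simp add: sum_nonneg_eq_0_iff)
    then have "U l = 0" using assms(2) l by (simp add: feasible_definite_def)
    then show ?thesis using True by simp
  next
    case False
    have "?N l \<ge> 0" by (intro sum_nonneg) auto
    with False have N: "?N l > 0" by linarith
    define l' where "l' = (\<lambda>i\<in>{1..n}. (1 / ?N l) * l i)"
    have "?N l' = (1 / ?N l) * ?N l"
      using N unfolding sum_distrib_left by (intro sum.cong) (auto simp: l'_def abs_mult)
    moreover have "(\<Sum>i=1..n. l' i) = (1 / ?N l) * (\<Sum>i=1..n. l i)"
      unfolding sum_distrib_left by (intro sum.cong) (auto simp: l'_def)
    moreover have "mono_on {1..n} l'"
      using l N by (auto intro!: mono_onI divide_right_mono simp: l'_def ordered_zero_sum_def dest: mono_onD)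
    moreover have "l' \<in> {1..n} \<rightarrow>\<^sub>E UNIV" by (simp add: l'_def)
    moreover have "(\<Sum>i=1..n. l i) = 0" using l by (simp add: ordered_zero_sum_def)
    ultimately have "l' \<in> K"
      using N by (simp add: K_def ordered_zero_sum_def)
    moreover have "U l' = (1 / ?N l) powr 1 * U l"
      unfolding l'_def by (rule feasible_definite_homogeneous[OF assms(2) _ l]) (use N in simp)
    moreover have "(1 / ?N l) powr 1 = 1 / ?N l"
      using N by simp
    ultimately have "c \<le> U l / ?N l" "U l / ?N l \<le> C"
      using c(3,4)[of l'] by simp_all
    then show ?thesis using N by (simp add: field_simps)
  qed
  show ?thesis
    using that[OF c(1,2)] * by blast
qed

lemma dispersion_statistic_bounds:
  assumes "n \<ge> 1" and "feasible_definite n 1 U"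
  obtains c C where "c > 0" "C > 0"
    "\<forall>x. (\<Sum>i=1..n. x i) = 0 \<longrightarrow> c * (\<Sum>i=1..n. \<bar>x i\<bar>) \<le> dispersion_statistic n U coord x \<and>
      dispersion_statistic n U coord x \<le> C * (\<Sum>i=1..n. \<bar>x i\<bar>)"
proof -
  from feasible_definite_bounds[OF assms] obtain c C where c: "c > 0" "C > 0"
    "\<forall>l\<in>ordered_zero_sum n. c * (\<Sum>i=1..n. \<bar>l i\<bar>) \<le> U l \<and> U l \<le> C * (\<Sum>i=1..n. \<bar>l i\<bar>)" by blast
  have "(\<Sum>k=1..n. \<bar>(\<lambda>k\<in>{1..n}. order_statistic n coord k x - sample_mean n coord x) k\<bar>) =
      (\<Sum>i=1..n. \<bar>x i\<bar>)" if "(\<Sum>i=1..n. x i) = 0" for x :: "nat \<Rightarrow> real"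
    using that sum_order_statistic[of abs n coord x] by (simp add: sample_mean_def)
  then show ?thesis
    using that[OF c(1,2)] bspec[OF c(3) centred_order_statistics_in_ordered_zero_sum[OF assms(1), of coord]]
    unfolding dispersion_statistic_def by metis
qed

section \<open>Joint law of the mean and the relative dispersion\<close>

text \<open>
  Lebesgue measure on the hyperplane of vectors with sum 0, in the coordinates of \<^const>\<open>close_sum\<close>.
\<close>

abbreviation mean_zero_space :: "nat \<Rightarrow> (nat \<Rightarrow> real) measure" where
  "mean_zero_space n \<equiv> PiM {1..<n} (\<lambda>_. lborel)"

definition shape_dispersion :: "nat \<Rightarrow> ((nat \<Rightarrow> real) \<Rightarrow> real) \<Rightarrow> (nat \<Rightarrow> real) \<Rightarrow> real" where
  "shape_dispersion n U w = dispersion_statistic n U coord (close_sum n w)"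

lemma PiM_density:
  fixes f :: "real \<Rightarrow> real"
  assumes I: "finite I" and f [measurable]: "f \<in> borel_measurable borel"
    and sf: "sigma_finite_measure (density lborel (\<lambda>x. ennreal (f x)))"
  shows "PiM I (\<lambda>_. density lborel (\<lambda>x. ennreal (f x))) =
    density (PiM I (\<lambda>_. lborel)) (\<lambda>x. \<Prod>i\<in>I. ennreal (f (x i)))"
proof -
  interpret L: product_sigma_finite "\<lambda>_. lborel :: real measure" by standard
  interpret sigma_finite_measure "density lborel (\<lambda>x. ennreal (f x))" by (rule sf)
  interpret D: product_sigma_finite "\<lambda>_. density lborel (\<lambda>x. ennreal (f x))" by standard
  show ?thesis
  proof (rule D.PiM_eqI[OF I, symmetric])
    show "sets (density (PiM I (\<lambda>_. lborel)) (\<lambda>x. \<Prod>i\<in>I. ennreal (f (x i)))) =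
        sets (PiM I (\<lambda>_. density lborel (\<lambda>x. ennreal (f x))))"
      by (simp cong: sets_PiM_cong)
    fix A assume "\<And>i. i \<in> I \<Longrightarrow> A i \<in> sets (density lborel (\<lambda>x. ennreal (f x)))"
    then have A [measurable]: "\<And>i. i \<in> I \<Longrightarrow> A i \<in> sets borel" by simp
    have PA: "PiE I A \<in> sets (PiM I (\<lambda>_. lborel))"
      using A I by (intro sets_PiM_I_finite) auto
    have "emeasure (density (PiM I (\<lambda>_. lborel)) (\<lambda>x. \<Prod>i\<in>I. ennreal (f (x i)))) (PiE I A) =
        (\<integral>\<^sup>+x. (\<Prod>i\<in>I. ennreal (f (x i))) * indicator (PiE I A) x \<partial>PiM I (\<lambda>_. lborel))"
      by (rule emeasure_density[OF _ PA]) measurable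
    also have "\<dots> = (\<integral>\<^sup>+x. (\<Prod>i\<in>I. ennreal (f (x i)) * indicator (A i) (x i)) \<partial>PiM I (\<lambda>_. lborel))"
    proof (rule nn_integral_cong)
      fix x assume "x \<in> space (PiM I (\<lambda>_. lborel :: real measure))"
      then have "indicator (PiE I A) x = (\<Prod>i\<in>I. indicator (A i) (x i) :: ennreal)"
        using I by (auto simp: indicator_def space_PiM PiE_iff prod_zero_iff)
      then show "(\<Prod>i\<in>I. ennreal (f (x i))) * indicator (PiE I A) x =
          (\<Prod>i\<in>I. ennreal (f (x i)) * indicator (A i) (x i))"
        by (simp add: prod.distrib)
    qed
    also have "\<dots> = (\<Prod>i\<in>I. \<integral>\<^sup>+x. ennreal (f x) * indicator (A i) x \<partial>lborel)"
      by (rule L.product_nn_integral_prod[OF I]) (use A in measurable)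
    also have "\<dots> = (\<Prod>i\<in>I. emeasure (density lborel (\<lambda>x. ennreal (f x))) (A i))"
      by (intro prod.cong refl) (use A in \<open>auto simp: emeasure_density\<close>)
    finally show "emeasure (density (PiM I (\<lambda>_. lborel)) (\<lambda>x. \<Prod>i\<in>I. ennreal (f (x i)))) (PiE I A) =
        (\<Prod>i\<in>I. emeasure (density lborel (\<lambda>x. ennreal (f x))) (A i))" .
  qed
qed

lemma sample_mean_sample_of_shape:
  assumes "n \<ge> 1"
  shows "sample_mean n coord (sample_of_shape n m w) = m"
  using sum_sample_of_shape[OF assms, of m w] assms by (simp add: sample_mean_def)

lemma dispersion_sample_of_shape:
  assumes "n \<ge> 1" "feasible_definite n 1 U" "m > 0"
  shows "dispersion_statistic n U coord (sample_of_shape n m w) = m * shape_dispersion n U w"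
proof -
  have "dispersion_statistic n U coord (sample_of_shape n m w) =
      dispersion_statistic n U (\<lambda>i x. m + m * x i) (close_sum n w)"
    by (rule dispersion_statistic_cong) (simp add: sample_of_shape_def algebra_simps)
  also have "\<dots> = m powr 1 * dispersion_statistic n U coord (close_sum n w)"
    by (rule dispersion_statistic_affine[OF assms])
  finally show ?thesis using assms(3) by (simp add: shape_dispersion_def)
qed

lemma measurable_shape_dispersion:
  assumes "n \<ge> 1" "feasible_definite n 1 U"
  shows "shape_dispersion n U \<in> borel_measurable (mean_zero_space n)"
proof -
  have "shape_dispersion n U = dispersion_statistic n U (\<lambda>i w. close_sum n w i)"
    by (simp add: fun_eq_iff shape_dispersion_def dispersion_statistic_def order_statistic_def sample_mean_def)
  then show ?thesis
    using borel_measurable_dispersion_statistic[OF assms, of "\<lambda>i w. close_sum n w i"] measurable_close_sum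
    by simp
qed

text \<open>
  For \<open>m > 0\<close> and up to the Jacobian, the density at the mean \<open>m\<close> of the part of the law of the sample for which the
  relative dispersion lies in \<open>B\<close>.
\<close>

definition shape_integral :: "nat \<Rightarrow> ((nat \<Rightarrow> real) \<Rightarrow> real) \<Rightarrow> (real \<Rightarrow> real) \<Rightarrow> real set \<Rightarrow> real \<Rightarrow> ennreal" where
  "shape_integral n U f B m = (\<integral>\<^sup>+w. indicator B (shape_dispersion n U w) *
     (\<Prod>i=1..n. ennreal (f (m * (1 + close_sum n w i)))) \<partial>mean_zero_space n)"

lemma measurable_shape_integral:
  assumes "n \<ge> 1" "feasible_definite n 1 U"
    and f [measurable]: "f \<in> borel_measurable borel" and B [measurable]: "B \<in> sets borel"
  shows "shape_integral n U f B \<in> borel_measurable borel"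
proof -
  interpret product_sigma_finite "\<lambda>_. lborel :: real measure" by standard
  interpret N: sigma_finite_measure "mean_zero_space n" by (rule sigma_finite) auto
  note measurable_shape_dispersion[OF assms(1,2), measurable]
  have "(\<lambda>p. ennreal (f (fst p * (1 + close_sum n (snd p) i)))) \<in> borel_measurable (borel \<Otimes>\<^sub>M mean_zero_space n)"
    if "i \<in> {1..n}" for i
    using measurable_compose[OF measurable_snd measurable_close_sum[OF that]] by measurable
  then have "(\<lambda>p. \<Prod>i=1..n. ennreal (f (fst p * (1 + close_sum n (snd p) i)))) \<in> borel_measurable (borel \<Otimes>\<^sub>M mean_zero_space n)"
    by (rule borel_measurable_prod_ennreal)
  then have "(\<lambda>(m, w). indicator B (shape_dispersion n U w) *
     (\<Prod>i=1..n. ennreal (f (m * (1 + close_sum n w i))))) \<in> borel_measurable (borel \<Otimes>\<^sub>M mean_zero_space n)"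
    unfolding case_prod_beta by measurable
  then show ?thesis
    unfolding shape_integral_def by (rule N.borel_measurable_nn_integral)
qed

text \<open>
  In the coordinates \<open>sample_of_shape n m w\<close> the condition on the mean involves only \<open>m\<close> and the condition on
  the quotient involves only \<open>w\<close>, so the density of the sample can be integrated over \<open>w\<close> first.
\<close>

lemma emeasure_mean_dispersion:
  fixes X :: "nat \<Rightarrow> 'a \<Rightarrow> real"
  assumes n: "n \<ge> 1" and U: "feasible_definite n 1 U"
    and M: "prob_space M" and indep: "prob_space.indep_vars M (\<lambda>_. borel) X {1..n}"
    and law: "\<And>i. i \<in> {1..n} \<Longrightarrow> distr M borel (X i) = density lborel (\<lambda>x. ennreal (f x))"
    and f [measurable]: "f \<in> borel_measurable borel" and f0: "\<And>x. x \<le> 0 \<Longrightarrow> f x = 0"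
    and C [measurable]: "C \<in> sets borel" and B [measurable]: "B \<in> sets borel"
  shows "emeasure M {\<omega> \<in> space M. sample_mean n X \<omega> \<in> C \<and>
      dispersion_statistic n U X \<omega> / sample_mean n X \<omega> \<in> B} =
    (\<integral>\<^sup>+m. indicator C m * (ennreal (real n * m ^ (n - 1)) * indicator {0<..} m * shape_integral n U f B m) \<partial>lborel)"
proof -
  interpret prob_space M by (rule M)
  have X [measurable]: "X i \<in> borel_measurable M" if "i \<in> {1..n}" for i
    using indep that by (auto simp: indep_vars_def)
  let ?P = "PiM {1..n} (\<lambda>_. lborel :: real measure)"
  let ?X = "\<lambda>\<omega>. \<lambda>i\<in>{1..n}. X i \<omega>"
  let ?S = "{x \<in> space ?P. sample_mean n coord x \<in> C \<and> dispersion_statistic n U coord x / sample_mean n coord x \<in> B}"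
  have comp: "(\<lambda>x. x i) \<in> borel_measurable ?P" if "i \<in> {1..n}" for i
    using that by measurable
  have [measurable]: "sample_mean n coord \<in> borel_measurable ?P"
    unfolding sample_mean_def using comp by measurable
  have [measurable]: "dispersion_statistic n U coord \<in> borel_measurable ?P"
    by (rule borel_measurable_dispersion_statistic[OF n U comp])
  have S [measurable]: "?S \<in> sets ?P" by measurable
  have "prob_space (density lborel (\<lambda>x. ennreal (f x)))"
    using law[of 1] n prob_space_distr[OF X[of 1]] by simp
  then have sf: "sigma_finite_measure (density lborel (\<lambda>x. ennreal (f x)))"
    by (simp add: prob_space.axioms(1) finite_measure.axioms(1))
  have XP [measurable]: "?X \<in> M \<rightarrow>\<^sub>M ?P" using X by measurable
  have "distr M ?P ?X = distr M (PiM {1..n} (\<lambda>_. borel)) ?X"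
    by (rule distr_cong) (auto intro!: sets_PiM_cong)
  also have "\<dots> = PiM {1..n} (\<lambda>i. distr M borel (X i))"
    using indep_vars_iff_distr_eq_PiM'[where I = "{1..n}" and M' = "\<lambda>_. borel" and X = X] n X indep by auto
  also have "\<dots> = PiM {1..n} (\<lambda>_. density lborel (\<lambda>x. ennreal (f x)))"
    by (rule PiM_cong) (auto simp: law)
  also have "\<dots> = density ?P (\<lambda>x. \<Prod>i=1..n. ennreal (f (x i)))"
    by (rule PiM_density[OF _ f sf]) simp
  finally have joint: "distr M ?P ?X = density ?P (\<lambda>x. \<Prod>i=1..n. ennreal (f (x i)))" .
  have "sample_mean n X \<omega> = sample_mean n coord (?X \<omega>)"
    "dispersion_statistic n U X \<omega> = dispersion_statistic n U coord (?X \<omega>)" for \<omega>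
    by (auto intro!: sample_mean_cong dispersion_statistic_cong)
  then have "{\<omega> \<in> space M. sample_mean n X \<omega> \<in> C \<and> dispersion_statistic n U X \<omega> / sample_mean n X \<omega> \<in> B} =
      ?X -` ?S \<inter> space M"
    by (auto simp: space_PiM)
  then have "emeasure M {\<omega> \<in> space M. sample_mean n X \<omega> \<in> C \<and> dispersion_statistic n U X \<omega> / sample_mean n X \<omega> \<in> B} =
      emeasure (density ?P (\<lambda>x. \<Prod>i=1..n. ennreal (f (x i)))) ?S"
    unfolding joint[symmetric] emeasure_distr[OF XP S] by (rule arg_cong)
  also have "\<dots> = (\<integral>\<^sup>+x. (\<Prod>i=1..n. ennreal (f (x i))) * indicator ?S x \<partial>?P)"
    by (rule emeasure_density) measurable
  also have "\<dots> = (\<integral>\<^sup>+m. ennreal (real n * m ^ (n - 1)) * indicator {0<..} m *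
      (\<integral>\<^sup>+w. (\<Prod>i=1..n. ennreal (f (sample_of_shape n m w i))) * indicator ?S (sample_of_shape n m w) \<partial>mean_zero_space n) \<partial>lborel)"
  proof (rule nn_integral_mean_and_shape[OF n])
    show "(\<Prod>i=1..n. ennreal (f (x i))) * indicator ?S x = 0" if "(\<Sum>i=1..n. x i) \<le> 0" for x
    proof -
      have "\<exists>i\<in>{1..n}. x i \<le> 0"
      proof (rule ccontr)
        assume "\<not> ?thesis"
        then have "(\<Sum>i=1..n. x i) > 0" using n by (intro sum_pos) (auto simp: not_le)
        with that show False by simp
      qed
      then obtain i where "i \<in> {1..n}" "f (x i) = 0" using f0 by blast
      then have "(\<Prod>i=1..n. ennreal (f (x i))) = 0" by (intro prod_zero bexI[of _ i]) auto
      then show ?thesis by simp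
    qed
  qed measurable
  also have "\<dots> = (\<integral>\<^sup>+m. indicator C m * (ennreal (real n * m ^ (n - 1)) * indicator {0<..} m * shape_integral n U f B m) \<partial>lborel)"
  proof (rule nn_integral_cong)
    fix m :: real
    show "ennreal (real n * m ^ (n - 1)) * indicator {0<..} m *
      (\<integral>\<^sup>+w. (\<Prod>i=1..n. ennreal (f (sample_of_shape n m w i))) * indicator ?S (sample_of_shape n m w) \<partial>mean_zero_space n) =
      indicator C m * (ennreal (real n * m ^ (n - 1)) * indicator {0<..} m * shape_integral n U f B m)"
    proof (cases "m > 0")
      case True
      have "(\<Prod>i=1..n. ennreal (f (sample_of_shape n m w i))) * indicator ?S (sample_of_shape n m w) =
          indicator C m * (indicator B (shape_dispersion n U w) * (\<Prod>i=1..n. ennreal (f (m * (1 + close_sum n w i)))))" for w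
      proof -
        have "(\<Prod>i=1..n. ennreal (f (sample_of_shape n m w i))) = (\<Prod>i=1..n. ennreal (f (m * (1 + close_sum n w i))))"
          by (rule prod.cong) (auto simp: sample_of_shape_def)
        moreover have "sample_of_shape n m w \<in> space ?P"
          by (simp add: space_PiM sample_of_shape_def)
        then have "sample_of_shape n m w \<in> ?S \<longleftrightarrow> m \<in> C \<and> shape_dispersion n U w \<in> B"
          using True by (simp add: sample_mean_sample_of_shape[OF n] dispersion_sample_of_shape[OF n U True])
        ultimately show ?thesis by (auto simp: indicator_def)
      qed
      then show ?thesis
        by (auto simp: indicator_def shape_integral_def)
    qed simp
  qed
  finally show ?thesis .
qed

section \<open>Independence for gamma samples\<close>

text \<open>
  The product formula on rectangles identifies the joint law with the product measure.
\<close>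

lemma (in prob_space) indep_var_if_emeasure_product:
  assumes X: "random_variable S X" and Y: "random_variable T Y"
    and prod: "\<And>A B. A \<in> sets S \<Longrightarrow> B \<in> sets T \<Longrightarrow>
      emeasure M {\<omega> \<in> space M. X \<omega> \<in> A \<and> Y \<omega> \<in> B} =
      emeasure M {\<omega> \<in> space M. X \<omega> \<in> A} * emeasure M {\<omega> \<in> space M. Y \<omega> \<in> B}"
  shows "indep_var S X T Y"
  unfolding indep_var_distribution_eq
proof (intro conjI X Y)
  interpret DX: prob_space "distr M S X" by (rule prob_space_distr[OF X])
  interpret DY: prob_space "distr M T Y" by (rule prob_space_distr[OF Y])
  note [measurable] = X Y
  show "distr M S X \<Otimes>\<^sub>M distr M T Y = distr M (S \<Otimes>\<^sub>M T) (\<lambda>x. (X x, Y x))"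
  proof (rule pair_measure_eqI)
    fix A B assume "A \<in> sets (distr M S X)" "B \<in> sets (distr M T Y)"
    then have AB [measurable]: "A \<in> sets S" "B \<in> sets T" by auto
    have "X -` A \<inter> space M = {\<omega> \<in> space M. X \<omega> \<in> A}" "Y -` B \<inter> space M = {\<omega> \<in> space M. Y \<omega> \<in> B}"
      "(\<lambda>x. (X x, Y x)) -` (A \<times> B) \<inter> space M = {\<omega> \<in> space M. X \<omega> \<in> A \<and> Y \<omega> \<in> B}" by auto
    then show "emeasure (distr M S X) A * emeasure (distr M T Y) B =
        emeasure (distr M (S \<Otimes>\<^sub>M T) (\<lambda>x. (X x, Y x))) (A \<times> B)"
      using AB prod[OF AB] by (simp add: emeasure_distr)
  qed (auto intro: DX.sigma_finite_measure_axioms DY.sigma_finite_measure_axioms)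
qed

lemma gamma_density_nonneg: "a > 0 \<Longrightarrow> b > 0 \<Longrightarrow> gamma_density a b x \<ge> 0"
  using Gamma_real_pos[of a] by (simp add: gamma_density_def)

lemma borel_measurable_gamma_density [measurable]: "gamma_density a b \<in> borel_measurable borel"
  unfolding gamma_density_def[abs_def] by measurable

text \<open>
  The variables separate: powers are multiplicative, and the exponents \<open>- m * (1 + w\<^sub>i) / b\<close> add up to
  \<open>- n * m / b\<close>.
\<close>

lemma shape_integral_gamma_density:
  assumes n: "n \<ge> 1" and U: "feasible_definite n 1 U" and ab: "a > 0" "b > 0" and m: "m > 0"
    and B [measurable]: "B \<in> sets borel"
  shows "shape_integral n U (gamma_density a b) B m =
    ennreal ((1 / (Gamma a * b powr a) * m powr (a - 1)) ^ n * exp (- real n * m / b)) *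
    (\<integral>\<^sup>+w. indicator B (shape_dispersion n U w) *
      ennreal (\<Prod>i=1..n. if 1 + close_sum n w i > 0 then (1 + close_sum n w i) powr (a - 1) else 0)
      \<partial>mean_zero_space n)"
proof -
  let ?c = "1 / (Gamma a * b powr a) * m powr (a - 1)"
  let ?h = "\<lambda>u :: real. if u > 0 then u powr (a - 1) else 0"
  note measurable_shape_dispersion[OF n U, measurable]
  have G: "Gamma a > 0" by (rule Gamma_real_pos[OF ab(1)])
  have dens: "gamma_density a b (m * u) = ?c * ?h u * exp (- (m * u / b))" for u
    using m by (simp add: gamma_density_def powr_mult zero_less_mult_iff)
  have prod: "(\<Prod>i=1..n. ennreal (gamma_density a b (m * (1 + close_sum n w i)))) =
      ennreal (?c ^ n * exp (- real n * m / b)) * ennreal (\<Prod>i=1..n. ?h (1 + close_sum n w i))" for w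
  proof -
    have "(\<Prod>i=1..n. exp (- (m * (1 + close_sum n w i) / b))) = exp (\<Sum>i=1..n. - (m * (1 + close_sum n w i) / b))"
      by (rule exp_sum[symmetric]) simp
    also have "(\<Sum>i=1..n. - (m * (1 + close_sum n w i) / b)) = - (m / b) * (\<Sum>i=1..n. 1 + close_sum n w i)"
      unfolding sum_distrib_left by (intro sum.cong) auto
    also have "(\<Sum>i=1..n. 1 + close_sum n w i) = real n"
      using sum_close_sum[OF n, of w] by (simp add: sum.distrib)
    finally have e: "(\<Prod>i=1..n. exp (- (m * (1 + close_sum n w i) / b))) = exp (- real n * m / b)"
      by (simp add: mult_ac)
    have "(\<Prod>i=1..n. ennreal (gamma_density a b (m * (1 + close_sum n w i)))) =
        ennreal (\<Prod>i=1..n. gamma_density a b (m * (1 + close_sum n w i)))"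
      using ab by (intro prod_ennreal) (auto intro: gamma_density_nonneg)
    also have "(\<Prod>i=1..n. gamma_density a b (m * (1 + close_sum n w i))) =
        ?c ^ n * (\<Prod>i=1..n. ?h (1 + close_sum n w i)) * exp (- real n * m / b)"
      unfolding dens prod.distrib e by (simp add: power_divide power_mult_distrib)
    also have "\<dots> = ?c ^ n * exp (- real n * m / b) * (\<Prod>i=1..n. ?h (1 + close_sum n w i))"
      by simp
    also have "ennreal \<dots> = ennreal (?c ^ n * exp (- real n * m / b)) * ennreal (\<Prod>i=1..n. ?h (1 + close_sum n w i))"
      using G by (intro ennreal_mult) (auto intro!: prod_nonneg)
    finally show ?thesis .
  qed
  have [measurable]: "(\<lambda>w. \<Prod>i=1..n. ?h (1 + close_sum n w i)) \<in> borel_measurable (mean_zero_space n)"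
  proof (rule borel_measurable_prod)
    fix i assume "i \<in> {1..n}"
    note measurable_close_sum[OF this, measurable]
    show "(\<lambda>w. ?h (1 + close_sum n w i)) \<in> borel_measurable (mean_zero_space n)" by measurable
  qed
  show ?thesis
    unfolding shape_integral_def prod
    by (subst nn_integral_cmult[symmetric]) (measurable, simp add: mult_ac)
qed

lemma indep_if_gamma:
  fixes X :: "nat \<Rightarrow> 'a \<Rightarrow> real"
  assumes n: "n \<ge> 1" and U: "feasible_definite n 1 U"
    and M: "prob_space M" and indep: "prob_space.indep_vars M (\<lambda>_. borel) X {1..n}"
    and law: "\<And>i. i \<in> {1..n} \<Longrightarrow> distr M borel (X i) = density lborel (\<lambda>x. ennreal (gamma_density a b x))"
    and ab: "a > 0" "b > 0"
  shows "prob_space.indep_var M borel (sample_mean n X)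
           borel (\<lambda>\<omega>. dispersion_statistic n U X \<omega> / sample_mean n X \<omega>)"
proof -
  interpret prob_space M by (rule M)
  have X [measurable]: "X i \<in> borel_measurable M" if "i \<in> {1..n}" for i
    using indep that by (auto simp: indep_vars_def)
  have [measurable]: "dispersion_statistic n U X \<in> borel_measurable M"
    by (rule borel_measurable_dispersion_statistic[OF n U X])
  have [measurable]: "sample_mean n X \<in> borel_measurable M"
    unfolding sample_mean_def by measurable
  let ?E = "\<lambda>C B. emeasure M {\<omega> \<in> space M. sample_mean n X \<omega> \<in> C \<and>
      dispersion_statistic n U X \<omega> / sample_mean n X \<omega> \<in> B}"
  define g where "g m = ennreal (real n * m ^ (n - 1)) * indicator {0<..} m *
    ennreal ((1 / (Gamma a * b powr a) * m powr (a - 1)) ^ n * exp (- real n * m / b))" for m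
  define \<nu> where "\<nu> C = (\<integral>\<^sup>+m. indicator C m * g m \<partial>lborel)" for C
  define K where "K B = (\<integral>\<^sup>+w. indicator B (shape_dispersion n U w) *
      ennreal (\<Prod>i=1..n. if 1 + close_sum n w i > 0 then (1 + close_sum n w i) powr (a - 1) else 0)
      \<partial>mean_zero_space n)" for B
  have E: "?E C B = \<nu> C * K B" if CB [measurable]: "C \<in> sets borel" "B \<in> sets borel" for C B
  proof -
    have "?E C B = (\<integral>\<^sup>+m. indicator C m * (ennreal (real n * m ^ (n - 1)) * indicator {0<..} m *
        shape_integral n U (gamma_density a b) B m) \<partial>lborel)"
      by (rule emeasure_mean_dispersion[OF n U M indep law _ _ CB]) (auto simp: gamma_density_def[of a b])
    also have "\<dots> = (\<integral>\<^sup>+m. indicator C m * g m * K B \<partial>lborel)"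
    proof (rule nn_integral_cong)
      fix m :: real
      show "indicator C m * (ennreal (real n * m ^ (n - 1)) * indicator {0<..} m *
          shape_integral n U (gamma_density a b) B m) = indicator C m * g m * K B"
      proof (cases "m > 0")
        case True
        show ?thesis
          unfolding shape_integral_gamma_density[OF n U ab True CB(2)] g_def K_def by (simp add: mult_ac)
      qed (simp add: g_def)
    qed
    also have "\<dots> = \<nu> C * K B"
      unfolding \<nu>_def g_def by (rule nn_integral_multc) measurable
    finally show ?thesis .
  qed
  have one: "\<nu> UNIV * K UNIV = 1"
    using E[of UNIV UNIV] emeasure_space_1 by simp
  show ?thesis
  proof (rule indep_var_if_emeasure_product)
    fix C B :: "real set" assume CB: "C \<in> sets borel" "B \<in> sets borel"
    have "\<nu> C * K B = \<nu> C * K B * (\<nu> UNIV * K UNIV)" by (simp add: one)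
    also have "\<dots> = (\<nu> C * K UNIV) * (\<nu> UNIV * K B)" by (simp only: mult_ac)
    finally show "?E C B = emeasure M {\<omega> \<in> space M. sample_mean n X \<omega> \<in> C} *
        emeasure M {\<omega> \<in> space M. dispersion_statistic n U X \<omega> / sample_mean n X \<omega> \<in> B}"
      using E[OF CB] E[OF CB(1), of UNIV] E[OF _ CB(2), of UNIV] by simp
  qed measurable
qed

section \<open>Functions that are convex or concave relative to the logarithm\<close>

text \<open>
  If \<open>g\<close> lies above one of its chords, subtract the slope of the chord: the difference takes equal
  values at the ends and a larger one in between, so it has a maximum in the interior. The leftmost
  maximum point is taken in order that the maximum is strict on one side.
\<close>

lemma convex_on_if_no_leftmost_interior_max:
  fixes g :: "real \<Rightarrow> real"
  assumes S: "convex S" and cont: "continuous_on S g"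
    and no_max: "\<And>a b m c. a \<in> S \<Longrightarrow> b \<in> S \<Longrightarrow> a < m \<Longrightarrow> m < b \<Longrightarrow>
      (\<And>x. x \<in> {a..b} \<Longrightarrow> g x - c * x \<le> g m - c * m) \<Longrightarrow>
      (\<And>x. x \<in> {a..<m} \<Longrightarrow> g x - c * x < g m - c * m) \<Longrightarrow> False"
  shows "convex_on S g"
proof (rule convex_on_linorderI[OF _ S], rule ccontr)
  fix t x y :: real
  assume t: "0 < t" "t < 1" and xy: "x \<in> S" "y \<in> S" "x < y"
    and "\<not> g ((1 - t) *\<^sub>R x + t *\<^sub>R y) \<le> (1 - t) * g x + t * g y"
  then have above: "g ((1 - t) * x + t * y) > (1 - t) * g x + t * g y" by simp
  define c where "c = (g y - g x) / (y - x)"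
  define h where "h u = g u - c * u" for u
  define z where "z = (1 - t) * x + t * y"
  have c: "c * (y - x) = g y - g x" using xy by (simp add: c_def)
  have hxy: "h x = h y" using c by (simp add: h_def algebra_simps)
  have "c * z = c * x + t * (c * (y - x))" by (simp add: z_def algebra_simps)
  then have "h z > h x" using above unfolding c by (simp add: h_def z_def algebra_simps)
  have "z - x = t * (y - x)" "y - z = (1 - t) * (y - x)" by (auto simp: z_def algebra_simps)
  then have z: "x < z" "z < y" using t xy by (metis diff_gt_0_iff_gt mult_pos_pos)+
  have sub: "{x..y} \<subseteq> S" using S xy closed_segment_eq_real_ivl[of x y]
    by (auto simp: convex_contains_segment)
  have conth: "continuous_on {x..y} h"
    unfolding h_def by (intro continuous_intros continuous_on_subset[OF cont sub])
  obtain u where u: "u \<in> {x..y}" "\<And>v. v \<in> {x..y} \<Longrightarrow> h v \<le> h u"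
    using continuous_attains_sup[of "{x..y}" h] xy conth by auto
  define A where "A = {x..y} \<inter> h -` {h u}"
  have "closed A" unfolding A_def by (intro continuous_closed_preimage conth) auto
  moreover have A: "A \<noteq> {}" "bdd_below A" using u by (auto simp: A_def)
  ultimately have m: "Inf A \<in> A" by (intro closed_contains_Inf)
  define m where "m = Inf A"
  have mA: "m \<in> {x..y}" "h m = h u" using m by (auto simp: A_def m_def)
  have "h u \<ge> h z" using u(2)[of z] z by auto
  then have "h m > h x" "h m > h y" using mA \<open>h z > h x\<close> hxy by auto
  then have "m \<noteq> x" "m \<noteq> y" by auto
  with mA have "x < m" "m < y" by auto
  moreover have "h v < h m" if "v \<in> {x..<m}" for v
  proof -
    have "v \<notin> A" using that cInf_lower[OF _ A(2), of v] by (auto simp: m_def)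
    then have "h v \<noteq> h m" using that mA by (auto simp: A_def)
    moreover have "h v \<le> h m" using u(2)[of v] that mA by auto
    ultimately show ?thesis by simp
  qed
  moreover have "h v \<le> h m" if "v \<in> {x..y}" for v using u(2)[OF that] mA by simp
  ultimately show False
    using no_max[of x y m c] xy by (auto simp: h_def)
qed

lemma ln_midpoint_above_chord: "ln (3 / 2) > (1 - 1 / 2) * ln 1 + 1 / 2 * ln (2 :: real)"
proof -
  have "ln 2 < ln ((3 / 2)\<^sup>2 :: real)" by (subst ln_less_cancel_iff) (auto simp: power2_eq_square)
  then show ?thesis by (simp add: ln_realpow)
qed

lemma affine_on_pos_if_chords:
  fixes g :: "real \<Rightarrow> real"
  assumes chord: "\<And>x y t. x > 0 \<Longrightarrow> y > 0 \<Longrightarrow> 0 \<le> t \<Longrightarrow> t \<le> 1 \<Longrightarrow>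
    g ((1 - t) * x + t * y) = (1 - t) * g x + t * g y"
  obtains a b where "\<And>x. x > 0 \<Longrightarrow> g x = a + b * x"
proof -
  have three: "(y - x) * g z = (y - z) * g x + (z - x) * g y" if "0 < x" "x \<le> z" "z \<le> y" "x < y" for x y z
  proof -
    define t where "t = (z - x) / (y - x)"
    have t: "0 \<le> t" "t \<le> 1" "z - x = t * (y - x)" using that by (auto simp: t_def)
    then have z: "z = (1 - t) * x + t * y" by (simp add: algebra_simps)
    have "g z = (1 - t) * g x + t * g y"
      using chord[of x y t] that t z by simp
    then have "(y - x) * g z = ((y - x) - t * (y - x)) * g x + t * (y - x) * g y" by algebra
    also have "(y - x) - t * (y - x) = y - z" using t(3) by simp
    finally show ?thesis using t(3) by simp
  qed
  have "g x = (2 * g 1 - g 2) + (g 2 - g 1) * x" if "x > 0" for x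
  proof -
    consider "x < 1" | "1 \<le> x" "x \<le> 2" | "x > 2" by linarith
    then show ?thesis
    proof cases
      case 1 then show ?thesis using three[of x 1 2] that by (simp add: algebra_simps)
    next
      case 2 then show ?thesis using three[of 1 x 2] that by (simp add: algebra_simps)
    next
      case 3 then show ?thesis using three[of 1 2 x] that by (simp add: algebra_simps)
    qed
  qed
  then show ?thesis using that by blast
qed

text \<open>
  The chord of \<open>ln\<close> over \<open>[1, 2]\<close> lies strictly below its midpoint value. Hence there is exactly one
  \<open>k\<close> for which \<open>L - k * ln\<close> meets its own chord at the same place. For parameters above it concavity
  fails, so the function is convex, and below it concave. All chord inequalities are affine in the
  parameter, so both survive in the limit at \<open>k\<close>.
\<close>

lemma ln_affine_if_convex_or_concave:
  fixes L :: "real \<Rightarrow> real"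
  assumes cc: "\<And>k. convex_on {0<..} (\<lambda>x. L x - k * ln x) \<or> concave_on {0<..} (\<lambda>x. L x - k * ln x)"
  shows "\<exists>a k b. \<forall>x>0. L x = a + k * ln x + b * x"
proof -
  define A where "A t x y = L ((1 - t) * x + t * y) - ((1 - t) * L x + t * L y)" for t x y
  define B where "B t x y = ln ((1 - t) * x + t * y) - ((1 - t) * ln x + t * ln y)" for t x y :: real
  define k where "k = A (1/2) 1 2 / B (1/2) 1 2"
  have B0: "B (1/2) 1 2 > 0" using ln_midpoint_above_chord by (simp add: B_def)
  have cv: "A t x y \<le> j * B t x y" if "convex_on {0<..} (\<lambda>x. L x - j * ln x)"
    "x > 0" "y > 0" "0 \<le> t" "t \<le> 1" for j t x y
    using convex_onD[OF that(1), of t x y] that by (simp add: A_def B_def algebra_simps)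
  have cc': "A t x y \<ge> j * B t x y" if "concave_on {0<..} (\<lambda>x. L x - j * ln x)"
    "x > 0" "y > 0" "0 \<le> t" "t \<le> 1" for j t x y
    using concave_onD[OF that(1), of t x y] that by (simp add: A_def B_def algebra_simps)
  have k: "A (1/2) 1 2 = k * B (1/2) 1 2" using B0 by (simp add: k_def)
  have upper: "A t x y \<le> j * B t x y" if "j > k" "x > 0" "y > 0" "0 \<le> t" "t \<le> 1" for j t x y
  proof -
    have "\<not> A (1/2) 1 2 \<ge> j * B (1/2) 1 2" using k B0 that by simp
    then have "\<not> concave_on {0<..} (\<lambda>x. L x - j * ln x)" using cc'[of j 1 2 "1/2"] by auto
    then show ?thesis using cc[of j] cv that by blast
  qed
  have lower: "A t x y \<ge> j * B t x y" if "j < k" "x > 0" "y > 0" "0 \<le> t" "t \<le> 1" for j t x y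
  proof -
    have "\<not> A (1/2) 1 2 \<le> j * B (1/2) 1 2" using k B0 that by simp
    then have "\<not> convex_on {0<..} (\<lambda>x. L x - j * ln x)" using cv[of j 1 2 "1/2"] by auto
    then show ?thesis using cc[of j] cc' that by blast
  qed
  have eq: "A t x y = k * B t x y" if *: "x > 0" "y > 0" "0 \<le> t" "t \<le> 1" for t x y
  proof (rule antisym)
    have right: "((\<lambda>j. j * B t x y) \<longlongrightarrow> k * B t x y) (at_right k)"
      by (intro tendsto_intros)
    show "A t x y \<le> k * B t x y"
      by (rule tendsto_lowerbound[OF right]) (auto simp: eventually_at_filter intro!: always_eventually upper *)
    have left: "((\<lambda>j. j * B t x y) \<longlongrightarrow> k * B t x y) (at_left k)"
      by (intro tendsto_intros)
    show "A t x y \<ge> k * B t x y"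
      by (rule tendsto_upperbound[OF left]) (auto simp: eventually_at_filter intro!: always_eventually lower *)
  qed
  obtain a b where "\<And>x. x > 0 \<Longrightarrow> L x - k * ln x = a + b * x"
  proof (rule affine_on_pos_if_chords)
    fix x y t :: real assume "x > 0" "y > 0" "0 \<le> t" "t \<le> 1"
    from eq[OF this] show "L ((1 - t) * x + t * y) - k * ln ((1 - t) * x + t * y) =
        (1 - t) * (L x - k * ln x) + t * (L y - k * ln y)"
      by (simp add: A_def B_def algebra_simps)
  qed blast
  then have "\<forall>x>0. L x = a + k * ln x + b * x" by (metis add.commute add.left_commute diff_add_cancel)
  then show ?thesis by blast
qed

section \<open>Integrable gamma kernels\<close>

lemma nn_integral_inverse:
  assumes "0 < a" "a \<le> b"
  shows "(\<integral>\<^sup>+x. ennreal (1 / x) * indicator {a..b} x \<partial>lborel) = ennreal (ln b - ln a)"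
proof (rule nn_integral_has_integral_lebesgue')
  show "((\<lambda>x. 1 / x) has_integral ln b - ln a) {a..b}"
    using assms by (intro fundamental_theorem_of_calculus)
      (auto intro!: derivative_eq_intros simp: has_real_derivative_iff_has_vector_derivative[symmetric])
qed (use assms in auto)

text \<open>
  If \<open>k \<le> - 1\<close>, the kernel dominates a multiple of \<open>1 / x\<close> near 0; if \<open>k > - 1\<close> but \<open>\<beta> \<ge> 0\<close>, it does
  so near infinity. In both cases there are intervals over which \<open>1 / x\<close> has arbitrarily large integral.
\<close>

lemma gamma_kernel_integrable_imp:
  assumes fin: "(\<integral>\<^sup>+x. ennreal (exp (\<alpha> + k * ln x + \<beta> * x)) * indicator {0<..} x \<partial>lborel) \<noteq> \<infinity>"
  shows "k > -1 \<and> \<beta> < 0"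
proof (rule ccontr)
  let ?I = "\<integral>\<^sup>+x. ennreal (exp (\<alpha> + k * ln x + \<beta> * x)) * indicator {0<..} x \<partial>lborel"
  assume neg: "\<not> ?thesis"
  have "\<exists>c>0. \<forall>K\<ge>0. \<exists>a b. 0 < a \<and> a \<le> b \<and> ln b - ln a = K \<and>
      (\<forall>x\<in>{a..b}. c * (1 / x) \<le> exp (\<alpha> + k * ln x + \<beta> * x))"
  proof (cases "k > -1")
    case True
    with neg have \<beta>: "\<beta> \<ge> 0" by simp
    have "exp \<alpha> * (1 / x) \<le> exp (\<alpha> + k * ln x + \<beta> * x)" if "x \<ge> 1" for x
    proof -
      have "exp \<alpha> * (1 / x) = exp (\<alpha> - ln x)" using that by (simp add: exp_diff)
      moreover have "- ln x \<le> k * ln x"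
        using True mult_right_mono[of "-1" k "ln x"] that by simp
      moreover have "0 \<le> \<beta> * x" using \<beta> that by simp
      ultimately show ?thesis by simp
    qed
    then have "0 < (1 :: real) \<and> 1 \<le> exp K \<and> ln (exp K) - ln 1 = K \<and>
        (\<forall>x\<in>{1..exp K}. exp \<alpha> * (1 / x) \<le> exp (\<alpha> + k * ln x + \<beta> * x))" if "K \<ge> 0" for K
      using that by auto
    then show ?thesis by (metis exp_gt_zero)
  next
    case False
    have "exp (\<alpha> - \<bar>\<beta>\<bar>) * (1 / x) \<le> exp (\<alpha> + k * ln x + \<beta> * x)" if x: "0 < x" "x \<le> 1" for x
    proof -
      have "exp (\<alpha> - \<bar>\<beta>\<bar>) * (1 / x) = exp (\<alpha> - \<bar>\<beta>\<bar> - ln x)" using that by (simp add: exp_diff)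
      moreover have "- ln x \<le> k * ln x"
        using False mult_right_mono_neg[of k "-1" "ln x"] that by simp
      moreover have "\<bar>\<beta> * x\<bar> \<le> \<bar>\<beta>\<bar>" using x by (simp add: abs_mult mult_left_le)
      ultimately show ?thesis by simp
    qed
    moreover have "x > 0" if "x \<ge> exp (- K)" for x K :: real
      using that exp_gt_zero[of "- K"] by linarith
    ultimately have "0 < exp (- K) \<and> exp (- K) \<le> 1 \<and> ln 1 - ln (exp (- K)) = K \<and>
        (\<forall>x\<in>{exp (- K)..1}. exp (\<alpha> - \<bar>\<beta>\<bar>) * (1 / x) \<le> exp (\<alpha> + k * ln x + \<beta> * x))" if "K \<ge> 0" for K
      using that by auto
    then show ?thesis by (metis exp_gt_zero)
  qed
  then obtain c where c: "c > 0" "\<And>K. K \<ge> 0 \<Longrightarrow> \<exists>a b. 0 < a \<and> a \<le> b \<and> ln b - ln a = K \<and>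
      (\<forall>x\<in>{a..b}. c * (1 / x) \<le> exp (\<alpha> + k * ln x + \<beta> * x))" by blast
  have large: "ennreal (c * K) \<le> ?I" if K: "K \<ge> 0" for K
  proof -
    obtain a b where ab: "0 < a" "a \<le> b" "ln b - ln a = K"
      "\<And>x. x \<in> {a..b} \<Longrightarrow> c * (1 / x) \<le> exp (\<alpha> + k * ln x + \<beta> * x)" using c(2)[OF K] by blast
    have "ennreal (c * K) = ennreal c * (\<integral>\<^sup>+x. ennreal (1 / x) * indicator {a..b} x \<partial>lborel)"
      using ab c(1) K by (simp add: nn_integral_inverse ennreal_mult)
    also have "\<dots> = (\<integral>\<^sup>+x. ennreal c * (ennreal (1 / x) * indicator {a..b} x) \<partial>lborel)"
      by (rule nn_integral_cmult[symmetric]) measurable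
    also have "\<dots> \<le> ?I"
    proof (rule nn_integral_mono)
      fix x
      show "ennreal c * (ennreal (1 / x) * indicator {a..b} x) \<le>
          ennreal (exp (\<alpha> + k * ln x + \<beta> * x)) * indicator {0<..} x"
      proof (cases "x \<in> {a..b}")
        case True
        have "ennreal c * ennreal (1 / x) = ennreal (c * (1 / x))"
          using ab(1) True c(1) by (subst ennreal_mult) auto
        then show ?thesis using True ab(1) ab(4)[OF True] by (auto intro!: ennreal_leI)
      qed simp
    qed
    finally show ?thesis .
  qed
  obtain r where r: "r \<ge> 0" "?I = ennreal r" using fin by (cases ?I) auto
  have "ennreal (c * ((r + 1) / c)) \<le> ?I" using r c by (intro large) auto
  then show False using r c by simp
qed

lemma nn_integral_gamma_kernel:
  assumes "a > 0" "b > 0"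
  shows "(\<integral>\<^sup>+x. ennreal (x powr (a - 1) * exp (- x / b)) * indicator {0<..} x \<partial>lborel) =
    ennreal (Gamma a * b powr a)"
proof -
  let ?h = "\<lambda>x. ennreal (x powr (a - 1) * exp (- x / b)) * indicator {0<..} x"
  have "(\<integral>\<^sup>+x. ?h x \<partial>lborel) = ennreal b * (\<integral>\<^sup>+x. ?h (0 + b * x) \<partial>lborel)"
    using assms(2) by (subst nn_integral_real_affine[of _ b 0]) auto
  also have "(\<lambda>x. ?h (0 + b * x)) = (\<lambda>x. ennreal (b powr (a - 1)) * ennreal (indicator {0..} x * x powr (a - 1) / exp x))"
    using assms(2)
    by (auto simp: fun_eq_iff indicator_def zero_less_mult_iff powr_mult ennreal_mult[symmetric] exp_minus field_simps)
  also have "(\<integral>\<^sup>+x. ennreal (b powr (a - 1)) * ennreal (indicator {0..} x * x powr (a - 1) / exp x) \<partial>lborel) =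
      ennreal (b powr (a - 1)) * ennreal (Gamma a)"
    by (subst nn_integral_cmult) (auto simp: Gamma_conv_nn_integral_real[OF assms(1)])
  also have "ennreal b * (ennreal (b powr (a - 1)) * ennreal (Gamma a)) = ennreal (Gamma a * b powr a)"
    using assms Gamma_real_pos[OF assms(1)] by (simp add: ennreal_mult[symmetric] powr_diff)
  finally show ?thesis .
qed

lemma gamma_density_if_gamma_kernel:
  assumes one: "(\<integral>\<^sup>+x. ennreal (exp (\<alpha> + k * ln x + \<beta> * x)) * indicator {0<..} x \<partial>lborel) = 1"
  obtains a b where "a > 0" "b > 0" "\<And>x. x > 0 \<Longrightarrow> exp (\<alpha> + k * ln x + \<beta> * x) = gamma_density a b x"
proof -
  have k: "k > -1" "\<beta> < 0" using gamma_kernel_integrable_imp[of \<alpha> k \<beta>] one by auto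
  define a where "a = k + 1"
  define b where "b = - 1 / \<beta>"
  have ab: "a > 0" "b > 0" using k by (auto simp: a_def b_def field_simps)
  have G: "Gamma a * b powr a > 0" using ab Gamma_real_pos[OF ab(1)] by simp
  have split: "exp (\<alpha> + k * ln x + \<beta> * x) = exp \<alpha> * (x powr (a - 1) * exp (- x / b))" if "x > 0" for x
    using that k by (simp add: powr_def a_def b_def exp_add mult_ac)
  have "1 = (\<integral>\<^sup>+x. ennreal (exp \<alpha>) * (ennreal (x powr (a - 1) * exp (- x / b)) * indicator {0<..} x) \<partial>lborel)"
    unfolding one[symmetric] by (intro nn_integral_cong) (auto simp: indicator_def split ennreal_mult)
  also have "\<dots> = ennreal (exp \<alpha>) * ennreal (Gamma a * b powr a)"
    by (subst nn_integral_cmult) (simp_all only: nn_integral_gamma_kernel[OF ab], measurable)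
  also have "\<dots> = ennreal (exp \<alpha> * (Gamma a * b powr a))"
    using G by (simp add: ennreal_mult[symmetric])
  finally have "exp \<alpha> * (Gamma a * b powr a) = 1"
    using G by (metis ennreal_1 ennreal_inj exp_ge_zero less_imp_le mult_nonneg_nonneg zero_le_one)
  then have "exp \<alpha> = 1 / (Gamma a * b powr a)"
    using G by (metis nonzero_eq_divide_eq less_irrefl)
  then show ?thesis using that[OF ab] split by (simp add: gamma_density_def)
qed

section \<open>Averages of a density over small shapes\<close>

text \<open>
  The part of the geometry of the sublevel sets of the dispersion that the characterization uses: for
  each \<open>e > 0\<close> a finite nonzero measure on shapes \<open>w\<close>, whose relative deviations \<open>d i w\<close> from the
  mean are of order \<open>e\<close>, add up to 0 and almost surely do not all vanish.
\<close>

locale small_shapes =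
  fixes n :: nat and \<sigma> :: "real \<Rightarrow> 'w measure" and d :: "nat \<Rightarrow> 'w \<Rightarrow> real" and R :: real
  assumes R: "R > 0"
    and finite: "e > 0 \<Longrightarrow> finite_measure (\<sigma> e)"
    and nonzero: "e > 0 \<Longrightarrow> emeasure (\<sigma> e) (space (\<sigma> e)) \<noteq> 0"
    and measurable_d: "i \<in> {1..n} \<Longrightarrow> d i \<in> borel_measurable (\<sigma> e)"
    and small: "w \<in> space (\<sigma> e) \<Longrightarrow> i \<in> {1..n} \<Longrightarrow> \<bar>d i w\<bar> \<le> R * e"
    and centred: "w \<in> space (\<sigma> e) \<Longrightarrow> (\<Sum>i=1..n. d i w) = 0"
    and proper: "e > 0 \<Longrightarrow> AE w in \<sigma> e. \<exists>i\<in>{1..n}. d i w \<noteq> 0"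
begin

definition avg :: "real \<Rightarrow> (real \<Rightarrow> real) \<Rightarrow> real \<Rightarrow> real" where
  "avg e f m = (\<integral>w. (\<Prod>i=1..n. f (m * (1 + d i w))) \<partial>\<sigma> e)"

definition pos_cont :: "(real \<Rightarrow> real) \<Rightarrow> bool" where
  "pos_cont f \<longleftrightarrow> f \<in> borel_measurable borel \<and> continuous_on {0<..} f \<and> (\<forall>x>0. f x > 0)"

lemma pos_cont_measurable: "pos_cont f \<Longrightarrow> f \<in> borel_measurable borel"
  by (simp add: pos_cont_def)

lemma scaled_in_interval:
  assumes "m > 0" "w \<in> space (\<sigma> e)" "i \<in> {1..n}"
  shows "m * (1 + d i w) \<in> {m * (1 - R * e)..m * (1 + R * e)}"
  using small[OF assms(2,3)] assms(1) by (auto intro!: mult_left_mono simp: abs_le_iff)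

lemma integrand_measurable:
  fixes f :: "real \<Rightarrow> real"
  assumes f: "f \<in> borel_measurable borel"
  shows "(\<lambda>w. \<Prod>i=1..n. f (m * (1 + d i w))) \<in> borel_measurable (\<sigma> e)"
proof (rule borel_measurable_prod)
  fix i assume "i \<in> {1..n}"
  note measurable_d[OF this, measurable]
  show "(\<lambda>w. f (m * (1 + d i w))) \<in> borel_measurable (\<sigma> e)"
    by (rule measurable_compose[OF _ f]) measurable
qed

lemma integrand_bounds:
  fixes f :: "real \<Rightarrow> real"
  assumes m: "m > 0" and w: "w \<in> space (\<sigma> e)" and lo: "lo \<ge> 0"
    and f: "\<And>x. x \<in> {m * (1 - R * e)..m * (1 + R * e)} \<Longrightarrow> lo \<le> f x \<and> f x \<le> hi"
  shows "lo ^ n \<le> (\<Prod>i=1..n. f (m * (1 + d i w)))" "(\<Prod>i=1..n. f (m * (1 + d i w))) \<le> hi ^ n"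
proof -
  have *: "lo \<le> f (m * (1 + d i w)) \<and> f (m * (1 + d i w)) \<le> hi" if "i \<in> {1..n}" for i
    using f scaled_in_interval[OF m w that] by blast
  have "(\<Prod>i=1..n. lo) \<le> (\<Prod>i=1..n. f (m * (1 + d i w)))"
    using * lo by (intro prod_mono) auto
  then show "lo ^ n \<le> (\<Prod>i=1..n. f (m * (1 + d i w)))" by simp
  have "(\<Prod>i=1..n. f (m * (1 + d i w))) \<le> (\<Prod>i=1..n. hi)"
    using * lo by (intro prod_mono) (auto intro: order_trans)
  then show "(\<Prod>i=1..n. f (m * (1 + d i w))) \<le> hi ^ n" by simp
qed

lemma positive_bounds_on_interval:
  assumes f: "pos_cont f" and "0 < a" "a \<le> b"
  obtains u v where "u \<in> {a..b}" "v \<in> {a..b}" "f u > 0" "\<forall>x\<in>{a..b}. f u \<le> f x \<and> f x \<le> f v"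
proof -
  have cont: "continuous_on {a..b} f"
    using f assms by (auto simp: pos_cont_def intro: continuous_on_subset)
  have ne: "{a..b} \<noteq> {}" using assms by simp
  obtain u where u: "u \<in> {a..b}" "\<forall>x\<in>{a..b}. f u \<le> f x"
    using continuous_attains_inf[OF compact_Icc ne cont] by blast
  obtain v where v: "v \<in> {a..b}" "\<forall>x\<in>{a..b}. f x \<le> f v"
    using continuous_attains_sup[OF compact_Icc ne cont] by blast
  have "f u > 0" using f u assms(2) by (simp add: pos_cont_def)
  with u v that show ?thesis by blast
qed

lemma interval_around_mean:
  assumes "m > 0" "e > 0" "R * e < 1"
  shows "0 < m * (1 - R * e)" "m * (1 - R * e) \<le> m" "m \<le> m * (1 + R * e)"
  using assms R by (auto simp: mult_le_cancel_left1 mult_le_cancel_left2)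

lemma scaled_pos:
  assumes "m > 0" "e > 0" "R * e < 1" "w \<in> space (\<sigma> e)" "i \<in> {1..n}"
  shows "m * (1 + d i w) > 0"
  using scaled_in_interval[OF assms(1,4,5)] interval_around_mean(1)[OF assms(1-3)] by simp

lemma integrable_integrand:
  assumes f: "pos_cont f" and m: "m > 0" and e: "e > 0" "R * e < 1"
  shows "integrable (\<sigma> e) (\<lambda>w. \<Prod>i=1..n. f (m * (1 + d i w)))"
proof -
  interpret finite_measure "\<sigma> e" using finite[OF e(1)] .
  note I = interval_around_mean[OF m e]
  let ?I = "{m * (1 - R * e)..m * (1 + R * e)}"
  obtain u v where uv: "u \<in> ?I" "v \<in> ?I" "f u > 0" "\<forall>x\<in>?I. f u \<le> f x \<and> f x \<le> f v"
    using positive_bounds_on_interval[OF f I(1) order_trans[OF I(2,3)]] by metis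
  show ?thesis
  proof (rule integrable_const_bound[where B = "f v ^ n"])
    show "AE w in \<sigma> e. norm (\<Prod>i=1..n. f (m * (1 + d i w))) \<le> f v ^ n"
    proof (rule AE_I2)
      fix w assume w: "w \<in> space (\<sigma> e)"
      have "0 \<le> f u ^ n" using uv(3) by simp
      also have "f u ^ n \<le> (\<Prod>i=1..n. f (m * (1 + d i w)))"
        by (rule integrand_bounds(1)[OF m w less_imp_le[OF uv(3)] bspec[OF uv(4)]])
      finally show "norm (\<Prod>i=1..n. f (m * (1 + d i w))) \<le> f v ^ n"
        using integrand_bounds(2)[OF m w less_imp_le[OF uv(3)] bspec[OF uv(4)]] by (simp only: real_norm_def abs_of_nonneg)
    qed
  qed (rule integrand_measurable[OF pos_cont_measurable[OF f]])
qed

text \<open>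
  The average of the products lies between the \<open>n\<close>-th powers of the minimum and the maximum of \<open>f\<close>
  on the interval reached by the arguments, so the intermediate value theorem finds the point.
\<close>

lemma avg_mean_value:
  assumes f: "pos_cont f" and m: "m > 0" and e: "e > 0" "R * e < 1"
  obtains y where "y \<in> {m * (1 - R * e)..m * (1 + R * e)}"
    "avg e f m = measure (\<sigma> e) (space (\<sigma> e)) * f y ^ n"
proof -
  interpret finite_measure "\<sigma> e" using finite[OF e(1)] .
  let ?I = "{m * (1 - R * e)..m * (1 + R * e)}"
  let ?M = "measure (\<sigma> e) (space (\<sigma> e))"
  note I = interval_around_mean[OF m e]
  have M: "?M > 0"
    using nonzero[OF e(1)] by (simp add: emeasure_eq_measure zero_less_measure_iff)
  obtain u v where uv: "u \<in> ?I" "v \<in> ?I" "f u > 0" "\<forall>x\<in>?I. f u \<le> f x \<and> f x \<le> f v"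
    using positive_bounds_on_interval[OF f I(1) order_trans[OF I(2,3)]] by metis
  have "(\<integral>w. f u ^ n \<partial>\<sigma> e) \<le> avg e f m"
    unfolding avg_def
    by (intro integral_mono integrable_integrand[OF f m e] integrand_bounds(1)[OF m _ less_imp_le[OF uv(3)] bspec[OF uv(4)]]) auto
  moreover have "avg e f m \<le> (\<integral>w. f v ^ n \<partial>\<sigma> e)"
    unfolding avg_def
    by (intro integral_mono integrable_integrand[OF f m e] integrand_bounds(2)[OF m _ less_imp_le[OF uv(3)] bspec[OF uv(4)]]) auto
  ultimately have "f u ^ n \<le> avg e f m / ?M" "avg e f m / ?M \<le> f v ^ n"
    using M by (simp_all add: field_simps)
  moreover have seg: "closed_segment u v \<subseteq> ?I"
    using uv(1,2) by (auto simp: closed_segment_eq_real_ivl)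
  moreover have "continuous_on (closed_segment u v) (\<lambda>x. f x ^ n)"
  proof -
    have "continuous_on {0<..} f" using f by (simp add: pos_cont_def)
    moreover have "closed_segment u v \<subseteq> {0<..}" using seg I(1) by fastforce
    ultimately have "continuous_on (closed_segment u v) f" by (rule continuous_on_subset)
    then show ?thesis by (rule continuous_on_power)
  qed
  ultimately obtain y where "y \<in> closed_segment u v" "f y ^ n = avg e f m / ?M"
    using IVT'_closed_segment_real[of "avg e f m / ?M" "\<lambda>x. f x ^ n" u v]
    by (auto simp: closed_segment_eq_real_ivl)
  then show ?thesis using that[of y] seg M by auto
qed

lemma avg_pos:
  assumes "pos_cont f" "m > 0" "e > 0" "R * e < 1"
  shows "avg e f m > 0"
proof -
  interpret finite_measure "\<sigma> e" using finite[OF assms(3)] .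
  obtain y where y: "y \<in> {m * (1 - R * e)..m * (1 + R * e)}"
    "avg e f m = measure (\<sigma> e) (space (\<sigma> e)) * f y ^ n"
    using avg_mean_value[OF assms] .
  then have "y > 0" using interval_around_mean[OF assms(2-4)] by auto
  then show ?thesis
    using y(2) assms(1) nonzero[OF assms(3)]
    by (simp add: emeasure_eq_measure zero_less_measure_iff pos_cont_def)
qed

lemma continuous_avg:
  assumes f: "pos_cont f" and e: "e > 0" "R * e < 1"
  shows "continuous_on {0<..} (avg e f)"
  unfolding continuous_on_sequentially
proof (intro allI ballI impI)
  interpret finite_measure "\<sigma> e" using finite[OF e(1)] .
  fix s :: "nat \<Rightarrow> real" and m
  assume "m \<in> {0<..}" "(\<forall>k. s k \<in> {0<..}) \<and> s \<longlonglongrightarrow> m"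
  then have m: "m > 0" and s: "\<And>k. s k > 0" "s \<longlonglongrightarrow> m" by auto
  let ?K = "insert m (range s)"
  have K: "compact ?K" using s(2) by (rule compact_sequence_with_limit)
  obtain a where a: "a \<in> ?K" "\<And>x. x \<in> ?K \<Longrightarrow> a \<le> x" using compact_attains_inf[OF K] by blast
  obtain b where b: "\<And>x. x \<in> ?K \<Longrightarrow> x \<le> b" using compact_attains_sup[OF K] by blast
  have ab: "0 < a" "a \<le> b" using a b m s by auto
  have Re: "0 < R * e" using R e by simp
  have "0 < a * (1 - R * e)" "a * (1 - R * e) \<le> b * (1 + R * e)"
    using ab e Re by (auto intro!: mult_mono)
  from positive_bounds_on_interval[OF f this] obtain u v where uv:
    "f u > 0" "\<forall>x\<in>{a * (1 - R * e)..b * (1 + R * e)}. f u \<le> f x \<and> f x \<le> f v" by metis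
  have fb: "norm (\<Prod>i=1..n. f (s k * (1 + d i w))) \<le> f v ^ n" if w: "w \<in> space (\<sigma> e)" for k w
  proof -
    have "a \<le> s k" "s k \<le> b" using a b by auto
    then have "a * (1 - R * e) \<le> s k * (1 - R * e)" "s k * (1 + R * e) \<le> b * (1 + R * e)"
      using e Re by (auto intro!: mult_right_mono)
    then have "{s k * (1 - R * e)..s k * (1 + R * e)} \<subseteq> {a * (1 - R * e)..b * (1 + R * e)}" by auto
    then have "f u ^ n \<le> (\<Prod>i=1..n. f (s k * (1 + d i w)))" "(\<Prod>i=1..n. f (s k * (1 + d i w))) \<le> f v ^ n"
      using integrand_bounds[OF s(1) w less_imp_le[OF uv(1)], of k f "f v"] uv(2) by blast+
    moreover have "0 \<le> f u ^ n" using uv(1) by simp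
    ultimately show ?thesis unfolding real_norm_def by linarith
  qed
  have "(\<lambda>k. \<integral>w. (\<Prod>i=1..n. f (s k * (1 + d i w))) \<partial>\<sigma> e) \<longlonglongrightarrow> (\<integral>w. (\<Prod>i=1..n. f (m * (1 + d i w))) \<partial>\<sigma> e)"
  proof (rule integral_dominated_convergence[where w = "\<lambda>_. f v ^ n"])
    show "AE w in \<sigma> e. (\<lambda>k. \<Prod>i=1..n. f (s k * (1 + d i w))) \<longlonglongrightarrow> (\<Prod>i=1..n. f (m * (1 + d i w)))"
    proof (rule AE_I2)
      fix w assume w: "w \<in> space (\<sigma> e)"
      show "(\<lambda>k. \<Prod>i=1..n. f (s k * (1 + d i w))) \<longlonglongrightarrow> (\<Prod>i=1..n. f (m * (1 + d i w)))"
      proof (rule tendsto_prod)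
        fix i assume i: "i \<in> {1..n}"
        show "(\<lambda>k. f (s k * (1 + d i w))) \<longlonglongrightarrow> f (m * (1 + d i w))"
          using f scaled_pos[OF _ e w i] s(1) m
          by (intro continuous_on_tendsto_compose[of "{0<..}" f] tendsto_intros s(2))
            (auto simp: pos_cont_def)
      qed
    qed
    show "AE w in \<sigma> e. norm (\<Prod>i=1..n. f (s k * (1 + d i w))) \<le> f v ^ n" for k
      by (rule AE_I2) (rule fb)
    show "(\<lambda>w. \<Prod>i=1..n. f (s k * (1 + d i w))) \<in> borel_measurable (\<sigma> e)" for k
      by (rule integrand_measurable[OF pos_cont_measurable[OF f]])
    show "(\<lambda>w. \<Prod>i=1..n. f (m * (1 + d i w))) \<in> borel_measurable (\<sigma> e)"
      by (rule integrand_measurable[OF pos_cont_measurable[OF f]])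
  qed simp
  then show "(avg e f \<circ> s) \<longlonglongrightarrow> avg e f m"
    by (simp add: avg_def o_def)
qed

lemma exists_negative:
  assumes "w \<in> space (\<sigma> e)" "\<exists>i\<in>{1..n}. d i w \<noteq> 0"
  shows "\<exists>i\<in>{1..n}. d i w < 0"
proof (rule ccontr)
  assume "\<not> ?thesis"
  then have "\<And>i. i \<in> {1..n} \<Longrightarrow> d i w \<ge> 0" by (simp add: not_less)
  with centred[OF assms(1)] have "\<forall>i\<in>{1..n}. d i w = 0"
    by (subst (asm) sum_nonneg_eq_0_iff) auto
  with assms(2) show False by blast
qed

text \<open>
  The deviations have sum 0 and are almost surely not all 0, so one of them is negative: almost every
  shape has an argument left of \<open>m\<close>, where the inequality is strict.
\<close>

lemma avg_strict_mono:
  assumes f: "pos_cont f" and g: "pos_cont g" and m: "m > 0" and e: "e > 0" "R * e < 1"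
    and le: "\<And>x. x \<in> {m * (1 - R * e)..m * (1 + R * e)} \<Longrightarrow> f x \<le> g x"
    and less: "\<And>x. x \<in> {m * (1 - R * e)..<m} \<Longrightarrow> f x < g x"
  shows "avg e f m < avg e g m"
proof -
  interpret finite_measure "\<sigma> e" using finite[OF e(1)] .
  show ?thesis
    unfolding avg_def
  proof (rule integral_less_AE_space[OF integrable_integrand[OF f m e] integrable_integrand[OF g m e] _ nonzero[OF e(1)]])
    show "AE w in \<sigma> e. (\<Prod>i=1..n. f (m * (1 + d i w))) < (\<Prod>i=1..n. g (m * (1 + d i w)))"
      using proper[OF e(1)] AE_space
    proof eventually_elim
      case (elim w)
      then obtain i where i: "i \<in> {1..n}" "d i w < 0" using exists_negative by blast
      have pos: "m * (1 + d j w) > 0" if "j \<in> {1..n}" for j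
        by (rule scaled_pos[OF m e elim(2) that])
      have "f (m * (1 + d i w)) < g (m * (1 + d i w))"
        using scaled_in_interval[OF m elim(2) i(1)] i(2) m by (intro less) (auto simp: mult_less_cancel_left2)
      moreover have "0 \<le> f (m * (1 + d j w)) \<and> f (m * (1 + d j w)) \<le> g (m * (1 + d j w))"
        "0 < g (m * (1 + d j w))" if "j \<in> {1..n}" for j
        using f g pos[OF that] le[OF scaled_in_interval[OF m elim(2) that]] by (auto simp: pos_cont_def less_imp_le)
      ultimately show ?case
        by (intro prod_mono_strict[of i]) (use i in auto)
    qed
  qed
qed

lemma pos_cont_gamma_kernel: "pos_cont (\<lambda>x. exp (\<alpha> + k * ln x + \<beta> * x))"
  unfolding pos_cont_def by (auto intro!: continuous_intros)

text \<open>
  The exponents \<open>\<beta> * m * d i w\<close> cancel since the deviations have sum 0. The constant that remains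
  depends on \<open>k\<close> and \<open>e\<close> only.
\<close>

lemma avg_gamma_kernel:
  assumes m: "m > 0" and e: "e > 0" "R * e < 1"
  shows "avg e (\<lambda>x. exp (\<alpha> + k * ln x + \<beta> * x)) m =
    exp (\<alpha> + k * ln m + \<beta> * m) ^ n * (\<integral>w. (\<Prod>i=1..n. exp (k * ln (1 + d i w))) \<partial>\<sigma> e)"
proof -
  let ?\<phi> = "\<lambda>x. exp (\<alpha> + k * ln x + \<beta> * x)"
  have "(\<Prod>i=1..n. ?\<phi> (m * (1 + d i w))) = ?\<phi> m ^ n * (\<Prod>i=1..n. exp (k * ln (1 + d i w)))"
    if w: "w \<in> space (\<sigma> e)" for w
  proof -
    have "?\<phi> (m * (1 + d i w)) = ?\<phi> m * exp (k * ln (1 + d i w)) * exp (\<beta> * m * d i w)"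
      if i: "i \<in> {1..n}" for i
    proof -
      have "1 * (1 + d i w) > 0"
        by (rule scaled_pos[OF zero_less_one e w i])
      then have "ln (m * (1 + d i w)) = ln m + ln (1 + d i w)"
        using m by (intro ln_mult_pos) auto
      then show ?thesis by (simp add: exp_add[symmetric] algebra_simps)
    qed
    then have "(\<Prod>i=1..n. ?\<phi> (m * (1 + d i w))) =
        (\<Prod>i=1..n. ?\<phi> m * exp (k * ln (1 + d i w)) * exp (\<beta> * m * d i w))"
      by (intro prod.cong) auto
    also have "\<dots> = ?\<phi> m ^ n * (\<Prod>i=1..n. exp (k * ln (1 + d i w))) * (\<Prod>i=1..n. exp (\<beta> * m * d i w))"
      by (simp add: prod.distrib)
    also have "(\<Prod>i=1..n. exp (\<beta> * m * d i w)) = exp (\<beta> * m * (\<Sum>i=1..n. d i w))"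
      by (simp add: exp_sum sum_distrib_left)
    finally show ?thesis using centred[OF w] by simp
  qed
  then have "avg e ?\<phi> m = (\<integral>w. ?\<phi> m ^ n * (\<Prod>i=1..n. exp (k * ln (1 + d i w))) \<partial>\<sigma> e)"
    unfolding avg_def by (intro Bochner_Integration.integral_cong) auto
  then show ?thesis by simp
qed

text \<open>
  Let \<open>e'\<close> tend to 0 in the hypothesis. By the mean value property, \<open>avg e' f m\<close> divided by the total
  mass tends to \<open>f m ^ n\<close>.
\<close>

lemma avg_proportional:
  assumes f: "pos_cont f" and e0: "e0 > 0" "R * e0 < 1"
    and cross: "\<And>e e' m m'. e \<in> {0<..e0} \<Longrightarrow> e' \<in> {0<..e0} \<Longrightarrow> m > 0 \<Longrightarrow> m' > 0 \<Longrightarrow>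
      avg e f m * avg e' f m' = avg e f m' * avg e' f m"
    and e: "e \<in> {0<..e0}" and m: "m > 0" and m': "m' > 0"
  shows "avg e f m * f m' ^ n = avg e f m' * f m ^ n"
proof -
  define \<epsilon> where "\<epsilon> k = e0 / real (Suc k)" for k
  have \<epsilon>: "\<epsilon> k \<in> {0<..e0}" "R * \<epsilon> k < 1" for k
  proof -
    show "\<epsilon> k \<in> {0<..e0}" using e0 by (auto simp: \<epsilon>_def field_simps)
    then have "R * \<epsilon> k \<le> R * e0" using R by auto
    then show "R * \<epsilon> k < 1" using e0 by linarith
  qed
  have \<epsilon>0: "\<epsilon> \<longlonglongrightarrow> 0"
    unfolding \<epsilon>_def using tendsto_mult_right_zero[OF LIMSEQ_inverse_real_of_nat, of e0] by (simp add: divide_inverse)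
  have "\<exists>y. (\<forall>k. y k \<in> {x * (1 - R * \<epsilon> k)..x * (1 + R * \<epsilon> k)} \<and>
      avg (\<epsilon> k) f x = measure (\<sigma> (\<epsilon> k)) (space (\<sigma> (\<epsilon> k))) * f (y k) ^ n)" if "x > 0" for x
    using avg_mean_value[OF f that _ \<epsilon>(2)] \<epsilon>(1) by (intro choice) (metis greaterThanAtMost_iff)
  then obtain y where y: "\<And>x k. x > 0 \<Longrightarrow> y x k \<in> {x * (1 - R * \<epsilon> k)..x * (1 + R * \<epsilon> k)}"
    "\<And>x k. x > 0 \<Longrightarrow> avg (\<epsilon> k) f x = measure (\<sigma> (\<epsilon> k)) (space (\<sigma> (\<epsilon> k))) * f (y x k) ^ n"
    by metis
  have lim: "(\<lambda>k. f (y x k) ^ n) \<longlonglongrightarrow> f x ^ n" if x: "x > 0" for x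
  proof -
    have "(\<lambda>k. x * (1 - R * \<epsilon> k)) \<longlonglongrightarrow> x * (1 - R * 0)" "(\<lambda>k. x * (1 + R * \<epsilon> k)) \<longlonglongrightarrow> x * (1 + R * 0)"
      by (intro tendsto_intros \<epsilon>0)+
    then have "y x \<longlonglongrightarrow> x"
      by (intro tendsto_sandwich[of "\<lambda>k. x * (1 - R * \<epsilon> k)" "y x" _ "\<lambda>k. x * (1 + R * \<epsilon> k)"])
        (use y(1)[OF x] in auto)
    moreover have "y x k > 0" for k
      using y(1)[OF x, of k] interval_around_mean(1)[OF x _ \<epsilon>(2)[of k]] \<epsilon>(1)[of k] by auto
    ultimately show ?thesis
      using f x by (intro tendsto_power continuous_on_tendsto_compose[of "{0<..}" f]) (auto simp: pos_cont_def)
  qed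
  have "avg e f m * f (y m' k) ^ n = avg e f m' * f (y m k) ^ n" for k
  proof -
    interpret finite_measure "\<sigma> (\<epsilon> k)" using finite \<epsilon>(1)[of k] by simp
    have "measure (\<sigma> (\<epsilon> k)) (space (\<sigma> (\<epsilon> k))) \<noteq> 0"
      using nonzero[of "\<epsilon> k"] \<epsilon>(1)[of k] by (simp add: emeasure_eq_measure)
    then show ?thesis
      using cross[OF e \<epsilon>(1)[of k] m m'] y(2)[OF m, of k] y(2)[OF m', of k] by simp
  qed
  then have "(\<lambda>k. avg e f m * f (y m' k) ^ n) \<longlonglongrightarrow> avg e f m' * f m ^ n"
    using lim[OF m] by (simp add: tendsto_mult_left)
  moreover have "(\<lambda>k. avg e f m * f (y m' k) ^ n) \<longlonglongrightarrow> avg e f m * f m' ^ n"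
    using lim[OF m'] by (intro tendsto_mult_left)
  ultimately show ?thesis by (rule LIMSEQ_unique[symmetric])
qed

lemma interval_shrinks:
  assumes "0 < a" "a < m" "m < b"
  obtains \<delta> where "\<delta> > 0" "\<And>e. 0 < e \<Longrightarrow> e < \<delta> \<Longrightarrow>
    R * e < 1 \<and> {m * (1 - R * e)..m * (1 + R * e)} \<subseteq> {a..b}"
proof -
  define r where "r = min (m - a) (b - m) / m"
  have r: "r > 0" "m * r \<le> m - a" "m * r \<le> b - m" "r < 1" using assms by (auto simp: r_def min_def field_simps)
  show ?thesis
  proof (rule that[of "r / R"])
    show "r / R > 0" using r R by simp
    fix e assume "0 < e" "e < r / R"
    then have "R * e < r" using R by (simp add: field_simps)
    moreover from this have "m * (R * e) < m * r" using assms by simp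
    ultimately show "R * e < 1 \<and> {m * (1 - R * e)..m * (1 + R * e)} \<subseteq> {a..b}"
      using r by (auto simp: algebra_simps)
  qed
qed

text \<open>
  With \<open>H e\<close> and \<open>G k e\<close> the constants of \<open>f\<close> and of the kernels, a kernel with exponent \<open>k\<close> that
  touches \<open>f\<close> from above at an interior point makes \<open>H e < G k e\<close> for small \<open>e\<close>, and one that touches
  from below makes \<open>H e > G k e\<close>. As \<open>e\<close> tends to 0, at least one of these eventual inequalities fails,
  which excludes the corresponding touching points. By \<open>convex_on_if_no_leftmost_interior_max\<close>, applied
  to \<open>ln f - k * ln\<close> or to its negative, that function is convex or concave.
\<close>

lemma gamma_kernel_if_proportional:
  assumes f: "pos_cont f" and e0: "e0 > 0"
    and proportional: "\<And>e m m'. e \<in> {0<..e0} \<Longrightarrow> m > 0 \<Longrightarrow> m' > 0 \<Longrightarrow> avg e f m * f m' ^ n = avg e f m' * f m ^ n"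
  shows "\<exists>\<alpha> k \<beta>. \<forall>x>0. f x = exp (\<alpha> + k * ln x + \<beta> * x)"
proof -
  have fpos: "f x > 0" if "x > 0" for x using f that by (simp add: pos_cont_def)
  define H where "H e = avg e f 1 / f 1 ^ n" for e
  define G where "G k e = (\<integral>w. (\<Prod>i=1..n. exp (k * ln (1 + d i w))) \<partial>\<sigma> e)" for k e
  have H: "avg e f m = f m ^ n * H e" if "e \<in> {0<..e0}" "m > 0" for e m
    using proportional[OF that zero_less_one] fpos[of 1] by (simp add: H_def field_simps)
  \<comment> \<open>The flag \<open>up\<close> selects the side: the kernel touches from above if it is true, from below otherwise.\<close>
  have touch: "\<exists>\<delta>>0. \<forall>e. 0 < e \<and> e < \<delta> \<longrightarrow> (if up then H e < G k e else H e > G k e)"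
    if ab: "0 < a" "a < m" "m < b"
      and le: "\<And>x. x \<in> {a..b} \<Longrightarrow> (if up then 1 else -1) * (ln (f x) - k * ln x - c * x) \<le> (if up then 1 else -1) * (ln (f m) - k * ln m - c * m)"
      and less: "\<And>x. x \<in> {a..<m} \<Longrightarrow> (if up then 1 else -1) * (ln (f x) - k * ln x - c * x) < (if up then 1 else -1) * (ln (f m) - k * ln m - c * m)"
    for a b m k c :: real and up
  proof -
    define \<alpha> where "\<alpha> = ln (f m) - k * ln m - c * m"
    define \<phi> where "\<phi> = (\<lambda>x. exp (\<alpha> + k * ln x + c * x))"
    have m: "m > 0" using ab by simp
    have \<phi>: "pos_cont \<phi>" unfolding \<phi>_def by (rule pos_cont_gamma_kernel)
    have \<phi>m: "\<phi> m = f m" using fpos[OF m] by (simp add: \<phi>_def \<alpha>_def)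
    have cmp: "f x \<le> \<phi> x \<longleftrightarrow> ln (f x) - k * ln x - c * x \<le> ln (f m) - k * ln m - c * m"
      "\<phi> x \<le> f x \<longleftrightarrow> ln (f x) - k * ln x - c * x \<ge> ln (f m) - k * ln m - c * m" if "x \<ge> a" for x
    proof -
      have "f x = exp (ln (f x))" using fpos[of x] ab that by simp
      then have "f x \<le> \<phi> x \<longleftrightarrow> ln (f x) \<le> \<alpha> + k * ln x + c * x"
        "\<phi> x \<le> f x \<longleftrightarrow> \<alpha> + k * ln x + c * x \<le> ln (f x)"
        unfolding \<phi>_def by (metis exp_le_cancel_iff)+
      then show "f x \<le> \<phi> x \<longleftrightarrow> ln (f x) - k * ln x - c * x \<le> ln (f m) - k * ln m - c * m"
        "\<phi> x \<le> f x \<longleftrightarrow> ln (f x) - k * ln x - c * x \<ge> ln (f m) - k * ln m - c * m"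
        by (auto simp: \<alpha>_def)
    qed
    have le': "if up then f x \<le> \<phi> x else \<phi> x \<le> f x" if "x \<in> {a..b}" for x
      using le[OF that] cmp[of x] that by (simp split: if_splits)
    have less': "if up then f x < \<phi> x else \<phi> x < f x" if "x \<in> {a..<m}" for x
      using less[OF that] cmp[of x] that unfolding not_le[symmetric] by (simp split: if_splits)
    obtain \<delta> where \<delta>: "\<delta> > 0" "\<And>e. 0 < e \<Longrightarrow> e < \<delta> \<Longrightarrow>
        R * e < 1 \<and> {m * (1 - R * e)..m * (1 + R * e)} \<subseteq> {a..b}"
      using interval_shrinks[OF ab] by blast
    have "if up then H e < G k e else H e > G k e" if e: "0 < e" "e < min \<delta> e0" for e
    proof -
      have Re: "R * e < 1" and sub: "{m * (1 - R * e)..m * (1 + R * e)} \<subseteq> {a..b}" using \<delta>(2)[of e] e by auto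
      have sub': "{m * (1 - R * e)..<m} \<subseteq> {a..<m}"
        using sub interval_around_mean(2,3)[OF m e(1) Re] by auto
      have "if up then avg e f m < avg e \<phi> m else avg e \<phi> m < avg e f m"
        using avg_strict_mono[OF f \<phi> m e(1) Re] avg_strict_mono[OF \<phi> f m e(1) Re] le' less' sub sub'
        by (auto simp: subset_iff split: if_splits)
      moreover have "avg e \<phi> m = f m ^ n * G k e"
        using avg_gamma_kernel[OF m e(1) Re, of \<alpha> k c] \<phi>m by (simp add: \<phi>_def G_def)
      moreover have "avg e f m = f m ^ n * H e" using H[of e m] e m by simp
      ultimately show ?thesis using fpos[OF m] by (simp split: if_splits)
    qed
    then show ?thesis using \<delta>(1) e0 by (intro exI[of _ "min \<delta> e0"]) auto
  qed
  have cont: "continuous_on {0<..} (\<lambda>x. ln (f x) - k * ln x)" for k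
  proof -
    have "continuous_on {0<..} f" using f by (simp add: pos_cont_def)
    moreover have "\<forall>x\<in>{0<..}. f x \<noteq> 0" by (metis fpos greaterThan_iff less_irrefl)
    ultimately show ?thesis
      by (intro continuous_on_diff continuous_on_mult continuous_on_ln continuous_on_const continuous_on_id) auto
  qed
  have "convex_on {0<..} (\<lambda>x. ln (f x) - k * ln x) \<or> concave_on {0<..} (\<lambda>x. ln (f x) - k * ln x)" for k
  proof (cases "\<forall>\<delta>>0. \<exists>e. 0 < e \<and> e < \<delta> \<and> H e \<ge> G k e")
    case True
    have "convex_on {0<..} (\<lambda>x. ln (f x) - k * ln x)"
    proof (rule convex_on_if_no_leftmost_interior_max[OF _ cont])
      fix a b m c :: real
      assume "a \<in> {0<..}" "b \<in> {0<..}" "a < m" "m < b"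
        "\<And>x. x \<in> {a..b} \<Longrightarrow> ln (f x) - k * ln x - c * x \<le> ln (f m) - k * ln m - c * m"
        "\<And>x. x \<in> {a..<m} \<Longrightarrow> ln (f x) - k * ln x - c * x < ln (f m) - k * ln m - c * m"
      with touch[of a m b True k c] obtain \<delta> where "\<delta> > 0" "\<And>e. 0 < e \<Longrightarrow> e < \<delta> \<Longrightarrow> H e < G k e"
        by auto
      with True show False by (meson leD)
    qed simp
    then show ?thesis ..
  next
    case False
    then obtain \<delta>0 where \<delta>0: "\<delta>0 > 0" "\<And>e. 0 < e \<Longrightarrow> e < \<delta>0 \<Longrightarrow> H e < G k e" by (meson not_le)
    have "convex_on {0<..} (\<lambda>x. - (ln (f x) - k * ln x))"
    proof (rule convex_on_if_no_leftmost_interior_max[OF _ continuous_on_minus[OF cont]])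
      fix a b m c :: real
      assume *: "a \<in> {0<..}" "b \<in> {0<..}" "a < m" "m < b"
        "\<And>x. x \<in> {a..b} \<Longrightarrow> - (ln (f x) - k * ln x) - c * x \<le> - (ln (f m) - k * ln m) - c * m"
        "\<And>x. x \<in> {a..<m} \<Longrightarrow> - (ln (f x) - k * ln x) - c * x < - (ln (f m) - k * ln m) - c * m"
      from touch[of a m b False k "-c"] * obtain \<delta> where "\<delta> > 0" "\<And>e. 0 < e \<Longrightarrow> e < \<delta> \<Longrightarrow> H e > G k e"
        by (auto simp: algebra_simps)
      then have "H (min \<delta> \<delta>0 / 2) > G k (min \<delta> \<delta>0 / 2)" "H (min \<delta> \<delta>0 / 2) < G k (min \<delta> \<delta>0 / 2)"
        using \<delta>0 by auto
      then show False by simp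
    qed simp
    then show ?thesis unfolding concave_on_def ..
  qed
  then obtain a k b where "\<forall>x>0. ln (f x) = a + k * ln x + b * x"
    using ln_affine_if_convex_or_concave[of "\<lambda>x. ln (f x)"] by blast
  then have "\<forall>x>0. f x = exp (a + k * ln x + b * x)" using fpos by (metis exp_ln)
  then show ?thesis by blast
qed

end

section \<open>Independence forces a gamma kernel\<close>

text \<open>
  The two-sided comparison of \<open>U\<close> with a norm encloses each sublevel set of the dispersion between two
  boxes of size proportional to \<open>e\<close>; this gives finiteness, positive measure and the bound on the
  deviations. Only the origin has no deviation, and since \<open>n \<ge> 2\<close> the hyperplane has positive
  dimension, so the origin is a null set.
\<close>

lemma small_shapes_sublevel:
  assumes n: "n \<ge> 2" and U: "feasible_definite n 1 U"
  obtains R where "small_shapes n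
    (\<lambda>e. restrict_space (mean_zero_space n) {w \<in> space (mean_zero_space n). shape_dispersion n U w \<le> e})
    (\<lambda>i w. close_sum n w i) R"
proof -
  have n1: "n \<ge> 1" using n by simp
  interpret product_sigma_finite "\<lambda>_. lborel :: real measure" by standard
  let ?N = "mean_zero_space n"
  define W where "W e = {w \<in> space ?N. shape_dispersion n U w \<le> e}" for e
  note measurable_shape_dispersion[OF n1 U, measurable]
  have W: "W e \<in> sets ?N" for e unfolding W_def by measurable
  have space_W: "space (restrict_space ?N (W e)) = W e" for e
    by (rule space_restrict_space2[OF W])
  have emeasure_W: "emeasure (restrict_space ?N (W e)) (W e) = emeasure ?N (W e)" for e
    by (rule emeasure_restrict_space) (use W[of e] in \<open>auto simp: W_def\<close>)
  obtain c C where cC: "c > 0" "C > 0"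
    "\<forall>x. (\<Sum>i=1..n. x i) = 0 \<longrightarrow> c * (\<Sum>i=1..n. \<bar>x i\<bar>) \<le> dispersion_statistic n U coord x \<and>
      dispersion_statistic n U coord x \<le> C * (\<Sum>i=1..n. \<bar>x i\<bar>)"
    by (rule dispersion_statistic_bounds[OF n1 U])
  have lo: "c * (\<Sum>i=1..n. \<bar>close_sum n w i\<bar>) \<le> shape_dispersion n U w"
    and hi: "shape_dispersion n U w \<le> C * (\<Sum>i=1..n. \<bar>close_sum n w i\<bar>)" for w
    unfolding shape_dispersion_def using cC(3) sum_close_sum[OF n1, of w] by auto
  have small: "\<bar>close_sum n w i\<bar> \<le> 1 / c * e" if "shape_dispersion n U w \<le> e" "i \<in> {1..n}" for w e i
  proof -
    have "c * \<bar>close_sum n w i\<bar> \<le> c * (\<Sum>i=1..n. \<bar>close_sum n w i\<bar>)"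
      using cC(1) that(2) by (intro mult_left_mono member_le_sum) auto
    also have "\<dots> \<le> e" using lo[of w] that(1) by linarith
    finally show ?thesis using cC(1) by (simp add: field_simps)
  qed
  have box: "PiE {1..<n} (\<lambda>_. {-r..r}) \<in> sets ?N" for r :: real
    by (rule sets_PiM_I_finite) auto
  have emeasure_box: "emeasure ?N (PiE {1..<n} (\<lambda>_. {-r..r})) = ennreal ((2 * r) ^ (n - 1))" if "r \<ge> 0" for r
    using that by (subst emeasure_PiM) (auto simp: ennreal_power)
  have null: "PiE {1..<n} (\<lambda>_. {0 :: real}) \<in> null_sets ?N"
  proof
    have "emeasure ?N (PiE {1..<n} (\<lambda>_. {0})) = (\<Prod>i\<in>{1..<n}. emeasure lborel {0 :: real})"
      by (rule emeasure_PiM) auto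
    then show "emeasure ?N (PiE {1..<n} (\<lambda>_. {0})) = 0" using n by simp
    show "PiE {1..<n} (\<lambda>_. {0}) \<in> sets ?N" by (rule sets_PiM_I_finite) auto
  qed
  have "small_shapes n (\<lambda>e. restrict_space ?N (W e)) (\<lambda>i w. close_sum n w i) (1 / c)"
  proof (rule small_shapes.intro)
    show "1 / c > 0" using cC by simp
    show "finite_measure (restrict_space ?N (W e))" if "e > 0" for e
    proof (rule finite_measureI)
      have "W e \<subseteq> PiE {1..<n} (\<lambda>_. {- (1 / c * e)..1 / c * e})"
      proof
        fix w assume w: "w \<in> W e"
        have "\<bar>w i\<bar> \<le> 1 / c * e" if "i \<in> {1..<n}" for i
          using small[of w e i] w that by (auto simp: close_sum_def W_def)
        with w show "w \<in> PiE {1..<n} (\<lambda>_. {- (1 / c * e)..1 / c * e})"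
          by (auto simp: W_def space_PiM PiE_iff abs_le_iff minus_le_iff)
      qed
      then have "emeasure ?N (W e) \<le> ennreal ((2 * (1 / c * e)) ^ (n - 1))"
        using that cC emeasure_mono[OF _ box] emeasure_box[of "1 / c * e"] by (metis divide_nonneg_pos less_imp_le mult_nonneg_nonneg zero_le_one)
      then show "emeasure (restrict_space ?N (W e)) (space (restrict_space ?N (W e))) \<noteq> \<infinity>"
        unfolding space_W emeasure_W by (auto simp: top_unique)
    qed
    show "emeasure (restrict_space ?N (W e)) (space (restrict_space ?N (W e))) \<noteq> 0" if e: "e > 0" for e
    proof -
      \<comment> \<open>In a box of half-width \<open>r\<close> the sum of the absolute deviations, the last one included, is at most
    \<open>2 * n * r = e / C\<close>.\<close>
  define r where "r = e / (2 * real n * C)"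
      have r: "r > 0" using e cC n by (simp add: r_def)
      have "PiE {1..<n} (\<lambda>_. {-r..r}) \<subseteq> W e"
      proof
        fix w assume w: "w \<in> PiE {1..<n} (\<lambda>_. {-r..r})"
        have wr: "\<bar>w i\<bar> \<le> r" if "i \<in> {1..<n}" for i using w that by (force simp: PiE_iff abs_le_iff)
        have "(\<Sum>i=1..<n. \<bar>w i\<bar>) \<le> real n * r"
          using sum_bounded_above[of "{1..<n}" "\<lambda>i. \<bar>w i\<bar>" r] wr r
          by (simp add: order_trans[OF _ mult_right_mono])
        moreover have "(\<Sum>i=1..n. \<bar>close_sum n w i\<bar>) = \<bar>\<Sum>i=1..<n. w i\<bar> + (\<Sum>i=1..<n. \<bar>w i\<bar>)"
          using n1 by (subst atLeastAtMost_eq_insert) (auto simp: close_sum_def)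
        moreover have "\<bar>\<Sum>i=1..<n. w i\<bar> \<le> (\<Sum>i=1..<n. \<bar>w i\<bar>)" by (rule sum_abs)
        ultimately have "(\<Sum>i=1..n. \<bar>close_sum n w i\<bar>) \<le> 2 * real n * r" by linarith
        then have "C * (\<Sum>i=1..n. \<bar>close_sum n w i\<bar>) \<le> C * (2 * real n * r)"
          using cC by (intro mult_left_mono) auto
        also have "\<dots> = e" using cC n by (simp add: r_def)
        finally show "w \<in> W e" using hi[of w] w by (auto simp: W_def space_PiM)
      qed
      then have "ennreal ((2 * r) ^ (n - 1)) \<le> emeasure ?N (W e)"
        using emeasure_mono[OF _ W] emeasure_box[of r] r by (metis less_imp_le)
      moreover have "ennreal ((2 * r) ^ (n - 1)) > 0" using r by simp
      ultimately show ?thesis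
        unfolding space_W emeasure_W by (metis leD)
    qed
    show "(\<lambda>w. close_sum n w i) \<in> borel_measurable (restrict_space ?N (W e))" if "i \<in> {1..n}" for i e
      by (rule measurable_restrict_space1[OF measurable_close_sum[OF that]])
    show "\<bar>close_sum n w i\<bar> \<le> 1 / c * e" if "w \<in> space (restrict_space ?N (W e))" "i \<in> {1..n}" for w e i
      using that unfolding space_W by (intro small) (auto simp: W_def)
    show "(\<Sum>i=1..n. close_sum n w i) = 0" for w by (rule sum_close_sum[OF n1])
    show "AE w in restrict_space ?N (W e). \<exists>i\<in>{1..n}. close_sum n w i \<noteq> 0" for e
    proof -
      have "AE w in ?N. \<exists>i\<in>{1..n}. close_sum n w i \<noteq> 0"
      proof (rule AE_I'[OF null], rule subsetI)
        fix w assume w: "w \<in> {w \<in> space ?N. \<not> (\<exists>i\<in>{1..n}. close_sum n w i \<noteq> 0)}"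
        have "w i = 0" if "i \<in> {1..<n}" for i
        proof -
          have "close_sum n w i = 0" "i \<noteq> n" using w that by auto
          then show ?thesis by (simp add: close_sum_def)
        qed
        moreover have "w i = undefined" if "i \<notin> {1..<n}" for i
          using w that by (auto simp: space_PiM PiE_iff extensional_def)
        ultimately show "w \<in> PiE {1..<n} (\<lambda>_. {0})" by (intro PiE_I) auto
      qed
      then show ?thesis
        using W[of e] by (subst AE_restrict_space_iff) (auto simp: W_def)
    qed
  qed
  then show ?thesis unfolding W_def by (rule that)
qed
lemma (in prob_space) indep_var_emeasure_product:
  assumes "indep_var S X T Y" "A \<in> sets S" "B \<in> sets T"
  shows "emeasure M {\<omega> \<in> space M. X \<omega> \<in> A \<and> Y \<omega> \<in> B} =
      emeasure M {\<omega> \<in> space M. X \<omega> \<in> A} * emeasure M {\<omega> \<in> space M. Y \<omega> \<in> B}"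
proof -
  have "X -` A \<inter> space M = {\<omega> \<in> space M. X \<omega> \<in> A}" "Y -` B \<inter> space M = {\<omega> \<in> space M. Y \<omega> \<in> B}"
    "(\<lambda>x. (X x, Y x)) -` (A \<times> B) \<inter> space M = {\<omega> \<in> space M. X \<omega> \<in> A \<and> Y \<omega> \<in> B}" by auto
  then show ?thesis
    using indep_varD[OF assms] by (simp add: emeasure_eq_measure ennreal_mult)
qed
lemma continuous_AE_zero_imp_zero:
  fixes g :: "real \<Rightarrow> real"
  assumes S: "open S" and cont: "continuous_on S g" and ae: "AE x in lborel. x \<in> S \<longrightarrow> g x = 0" and x: "x \<in> S"
  shows "g x = 0"
proof (rule ccontr)
  assume "g x \<noteq> 0"
  let ?T = "S \<inter> g -` (- {0})"
  have "open ?T" by (rule continuous_open_preimage[OF cont S]) auto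
  moreover have "x \<in> ?T" using x \<open>g x \<noteq> 0\<close> by simp
  ultimately obtain r where r: "r > 0" "ball x r \<subseteq> ?T" by (rule openE)
  have "AE y in lborel. y \<notin> ball x r"
    using ae by eventually_elim (use r in auto)
  then have "ball x r \<in> null_sets lborel"
    by (subst AE_iff_null_sets) auto
  then have "emeasure lborel {x - r<..<x + r} = 0"
    by (simp add: null_sets_def ball_eq_greaterThanLessThan)
  then show False using r by simp
qed

text \<open>
  By independence, restricting to the event that the relative dispersion is at most \<open>e\<close> changes the
  density of the mean only by the constant factor \<open>p e\<close>. Up to the Jacobian the restricted density at
  \<open>m\<close> is \<open>avg e f m\<close>, so \<open>p e' * avg e f m = p e * avg e' f m\<close>, first for almost all \<open>m\<close> and
  by continuity for all.
\<close>

lemma gamma_if_indep: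
  fixes X :: "nat \<Rightarrow> 'a \<Rightarrow> real"
  assumes n: "n \<ge> 2" and U: "feasible_definite n 1 U"
    and M: "prob_space M" and indep: "prob_space.indep_vars M (\<lambda>_. borel) X {1..n}"
    and law: "\<And>i. i \<in> {1..n} \<Longrightarrow> distr M borel (X i) = density lborel (\<lambda>x. ennreal (f x))"
    and f [measurable]: "f \<in> borel_measurable borel" and f0: "\<And>x. x \<le> 0 \<Longrightarrow> f x = 0"
    and fpos: "\<And>x. x > 0 \<Longrightarrow> f x > 0" and fcont: "continuous_on {0<..} f"
    and ind: "prob_space.indep_var M borel (sample_mean n X)
           borel (\<lambda>\<omega>. dispersion_statistic n U X \<omega> / sample_mean n X \<omega>)"
  shows "\<exists>\<alpha> k \<beta>. \<forall>x>0. f x = exp (\<alpha> + k * ln x + \<beta> * x)"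
proof -
  have n1: "n \<ge> 1" using n by simp
  interpret prob_space M by (rule M)
  let ?N = "mean_zero_space n"
  let ?W = "\<lambda>e. {w \<in> space ?N. shape_dispersion n U w \<le> e}"
  note measurable_shape_dispersion[OF n1 U, measurable]
  have W: "?W e \<in> sets ?N" for e by measurable
  obtain R where "small_shapes n (\<lambda>e. restrict_space ?N (?W e)) (\<lambda>i w. close_sum n w i) R"
    by (rule small_shapes_sublevel[OF n U])
  then interpret small_shapes n "\<lambda>e. restrict_space ?N (?W e)" "\<lambda>i w. close_sum n w i" R .
  have fnn: "f x \<ge> 0" for x
    using f0[of x] fpos[of x] by (cases "x > 0") auto
  have pc: "pos_cont f" using f fpos fcont by (simp add: pos_cont_def)
  \<comment> \<open>For \<open>e \<le> e0\<close> the deviations are at most 1/2, which keeps all arguments of \<open>f\<close> positive.\<close>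
  define e0 where "e0 = 1 / (2 * R)"
  have e0: "e0 > 0" "R * e0 < 1" using R by (auto simp: e0_def)
  have Re: "R * e < 1" if "e \<in> {0<..e0}" for e
  proof -
    have "R * e \<le> R * e0" using that R by (intro mult_left_mono) auto
    then show ?thesis using e0(2) by linarith
  qed
  have Q: "shape_integral n U f {..e} m = ennreal (avg e f m)" if e: "e \<in> {0<..e0}" and m: "m > 0" for e m
  proof -
    have "shape_integral n U f {..e} m =
        (\<integral>\<^sup>+w. (\<Prod>i=1..n. ennreal (f (m * (1 + close_sum n w i)))) * indicator (?W e) w \<partial>?N)"
      unfolding shape_integral_def by (rule nn_integral_cong) (auto simp: indicator_def)
    also have "\<dots> = (\<integral>\<^sup>+w. (\<Prod>i=1..n. ennreal (f (m * (1 + close_sum n w i)))) \<partial>restrict_space ?N (?W e))"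
      by (rule nn_integral_restrict_space[symmetric]) (use W in auto)
    also have "\<dots> = (\<integral>\<^sup>+w. ennreal (\<Prod>i=1..n. f (m * (1 + close_sum n w i))) \<partial>restrict_space ?N (?W e))"
      by (intro nn_integral_cong prod_ennreal fnn)
    also have "\<dots> = ennreal (avg e f m)"
      unfolding avg_def
    proof (rule nn_integral_eq_integral)
      show "integrable (restrict_space ?N (?W e)) (\<lambda>w. \<Prod>i=1..n. f (m * (1 + close_sum n w i)))"
        using integrable_integrand[OF pc m _ Re[OF e]] e by simp
      show "AE w in restrict_space ?N (?W e). 0 \<le> (\<Prod>i=1..n. f (m * (1 + close_sum n w i)))"
        by (intro AE_I2 prod_nonneg fnn)
    qed
    finally show ?thesis .
  qed
  define p where "p e = prob {\<omega> \<in> space M. dispersion_statistic n U X \<omega> / sample_mean n X \<omega> \<in> {..e}}" for e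
  define q where "q e m = ennreal (real n * m ^ (n - 1)) * indicator {0<..} m * shape_integral n U f {..e} m" for e m
  have q [measurable]: "q e \<in> borel_measurable borel" for e
    unfolding q_def using measurable_shape_integral[OF n1 U f, of "{..e}"] by measurable
  have q_pos: "q e m = ennreal (real n * m ^ (n - 1) * avg e f m)" if "e \<in> {0<..e0}" "m > 0" for e m
    using that Q[OF that] avg_pos[OF pc that(2) _ Re[OF that(1)]]
    by (simp add: q_def ennreal_mult less_imp_le)
  have law_q: "(\<integral>\<^sup>+m. indicator C m * q e m \<partial>lborel) =
      ennreal (prob {\<omega> \<in> space M. sample_mean n X \<omega> \<in> C}) * ennreal (p e)" if C: "C \<in> sets borel" for C e
    using emeasure_mean_dispersion[OF n1 U M indep law f f0 C, of "{..e}"]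
      indep_var_emeasure_product[OF ind C, of "{..e}"]
    by (simp add: q_def p_def emeasure_eq_measure)
  have p_pos: "p e > 0" if e: "e \<in> {0<..e0}" for e
  proof (rule ccontr)
    assume "\<not> p e > 0"
    then have "p e = 0" by (simp add: p_def zero_less_measure_iff)
    then have "(\<integral>\<^sup>+m. q e m \<partial>lborel) = 0" using law_q[of UNIV e] by simp
    then have "AE m in lborel. q e m = 0" by (subst (asm) nn_integral_0_iff_AE) auto
    then have "AE m in lborel. m \<in> {0<..} \<longrightarrow> avg e f m = 0"
    proof eventually_elim
      case (elim m)
      show ?case
      proof
        assume m: "m \<in> {0<..}"
        then have "avg e f m > 0" using avg_pos[OF pc _ _ Re[OF e]] e by auto
        then show "avg e f m = 0" using elim q_pos[OF e, of m] m n1 by (simp add: mult_le_0_iff not_le[symmetric])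
      qed
    qed
    from continuous_AE_zero_imp_zero[OF open_greaterThan _ this, of 1]
    have "avg e f 1 = 0" using continuous_avg[OF pc _ Re[OF e]] e by simp
    then show False using avg_pos[OF pc _ _ Re[OF e], of 1] e by simp
  qed
  have ratio: "p e' * avg e f m = p e * avg e' f m" if e: "e \<in> {0<..e0}" "e' \<in> {0<..e0}" and m: "m > 0" for e e' m
  proof -
    have "density lborel (\<lambda>m. ennreal (p e') * q e m) = density lborel (\<lambda>m. ennreal (p e) * q e' m)"
    proof (rule measure_eqI)
      fix C assume "C \<in> sets (density lborel (\<lambda>m. ennreal (p e') * q e m))"
      then have C [measurable]: "C \<in> sets borel" by simp
      have "emeasure (density lborel (\<lambda>m. ennreal (p a) * q b m)) C =
          ennreal (p a) * (\<integral>\<^sup>+m. indicator C m * q b m \<partial>lborel)" for a b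
        by (subst nn_integral_cmult[symmetric]) (measurable, simp add: emeasure_density mult_ac)
      then show "emeasure (density lborel (\<lambda>m. ennreal (p e') * q e m)) C =
          emeasure (density lborel (\<lambda>m. ennreal (p e) * q e' m)) C"
        by (simp add: law_q[OF C] mult_ac)
    qed simp
    then have "AE m in lborel. ennreal (p e') * q e m = ennreal (p e) * q e' m"
      by (rule sigma_finite_measure.density_unique[OF sigma_finite_lborel, rotated 2]) measurable
    then have "AE m in lborel. m \<in> {0<..} \<longrightarrow> p e' * avg e f m - p e * avg e' f m = 0"
    proof eventually_elim
      case (elim m)
      show ?case
      proof
        assume "m \<in> {0<..}"
        then have m: "m > 0" by simp
        have a: "avg e f m > 0" "avg e' f m > 0"
          using avg_pos[OF pc m _ Re[OF e(1)]] avg_pos[OF pc m _ Re[OF e(2)]] e by auto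
        have "ennreal (p e' * (real n * m ^ (n - 1) * avg e f m)) = ennreal (p e * (real n * m ^ (n - 1) * avg e' f m))"
          using elim m a p_pos[OF e(1)] p_pos[OF e(2)] unfolding q_pos[OF e(1) m] q_pos[OF e(2) m]
          by (simp add: ennreal_mult less_imp_le)
        then have "p e' * (real n * m ^ (n - 1) * avg e f m) = p e * (real n * m ^ (n - 1) * avg e' f m)"
          using m a p_pos[OF e(1)] p_pos[OF e(2)] by (subst (asm) ennreal_inj) (auto intro!: mult_nonneg_nonneg less_imp_le)
        then have "real n * m ^ (n - 1) * (p e' * avg e f m - p e * avg e' f m) = 0"
          by (simp add: algebra_simps)
        then show "p e' * avg e f m - p e * avg e' f m = 0" using m n1 by simp
      qed
    qed
    then have "p e' * avg e f m - p e * avg e' f m = 0"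
    proof (rule continuous_AE_zero_imp_zero[OF open_greaterThan, rotated])
      show "continuous_on {0<..} (\<lambda>m. p e' * avg e f m - p e * avg e' f m)"
        using continuous_avg[OF pc _ Re[OF e(1)]] continuous_avg[OF pc _ Re[OF e(2)]] e
        by (intro continuous_on_diff continuous_on_mult continuous_on_const) auto
    qed (use m in simp)
    then show ?thesis by simp
  qed
  have cross: "avg e f m * avg e' f m' = avg e f m' * avg e' f m"
    if e: "e \<in> {0<..e0}" "e' \<in> {0<..e0}" and m: "m > 0" "m' > 0" for e e' m m'
  proof -
    have "p e' * (avg e f m * avg e' f m') = p e * avg e' f m * avg e' f m'"
      by (simp only: mult.assoc[symmetric] ratio[OF e m(1)])
    also have "\<dots> = p e' * avg e f m' * avg e' f m"
      unfolding ratio[OF e m(2)] by simp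
    finally have "p e' * (avg e f m * avg e' f m') = p e' * (avg e f m' * avg e' f m)"
      by simp
    then show ?thesis using p_pos[OF e(2)] by simp
  qed
  show ?thesis
    by (rule gamma_kernel_if_proportional[OF pc e0(1) avg_proportional[OF pc e0 cross]])
qed

theorem theorem1:
  fixes n :: nat
    and M :: "'a measure"
    and X :: "nat \<Rightarrow> 'a \<Rightarrow> real"
    and F :: "real measure"
    and f :: "real \<Rightarrow> real"
    and U :: "(nat \<Rightarrow> real) \<Rightarrow> real"
  assumes "n \<ge> 3"
    and "prob_space M"
    and "prob_space.indep_vars M (\<lambda>_. borel) X {1..n}"
    and "\<And>i. i \<in> {1..n} \<Longrightarrow> distr M borel (X i) = F"
    and "\<And>i. i \<in> {1..n} \<Longrightarrow> AE \<omega> in M. X i \<omega> > 0"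
    and "f \<in> borel_measurable borel"
    and "\<And>x. f x \<ge> 0"
    and "F = density lborel (\<lambda>x. ennreal (f x))"
    and "continuous_on {0<..} f"
    and "\<And>x. x > 0 \<Longrightarrow> f x > 0"
    and "feasible_definite n 1 U"
  shows "prob_space.indep_var M
           borel (sample_mean n X)
           borel (\<lambda>\<omega>. dispersion_statistic n U X \<omega> / sample_mean n X \<omega>)
         \<longleftrightarrow> gamma_distribution F"
proof
  assume "gamma_distribution F"
  then obtain a b where ab: "a > 0" "b > 0" "F = density lborel (\<lambda>x. ennreal (gamma_density a b x))"
    by (auto simp: gamma_distribution_def)
  have "n \<ge> 1" using assms(1) by simp
  from indep_if_gamma[OF this assms(11,2,3) _ ab(1,2)]
  show "prob_space.indep_var M borel (sample_mean n X)
      borel (\<lambda>\<omega>. dispersion_statistic n U X \<omega> / sample_mean n X \<omega>)"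
    using assms(4) ab(3) by simp
next
  assume ind: "prob_space.indep_var M borel (sample_mean n X)
      borel (\<lambda>\<omega>. dispersion_statistic n U X \<omega> / sample_mean n X \<omega>)"
  interpret prob_space M by (rule assms(2))
  note assms(6) [measurable]
  have one: "1 \<in> {1..n}" using assms(1) by simp
  have X1: "X 1 \<in> borel_measurable M" using assms(3) one by (auto simp: indep_vars_def)
  have F: "prob_space F" using prob_space_distr[OF X1] assms(4)[OF one] by simp
  \<comment> \<open>The given density may be positive on a null set of nonpositive numbers; this version vanishes there.\<close>
  define f' where "f' x = (if x > 0 then f x else 0)" for x
  have f' [measurable]: "f' \<in> borel_measurable borel" unfolding f'_def[abs_def] by measurable
  have "AE x in F. x > 0"
    unfolding assms(4)[OF one, symmetric] using assms(5)[OF one] X1 by (subst AE_distr_iff) auto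
  then have "AE x in lborel. ennreal (f x) > 0 \<longrightarrow> x > 0"
    unfolding assms(8) by (subst (asm) AE_density) auto
  then have "AE x in lborel. ennreal (f x) = ennreal (f' x)"
  proof eventually_elim
    case (elim x)
    then show ?case using assms(7)[of x] by (auto simp: f'_def ennreal_less_zero_iff ennreal_eq_0_iff)
  qed
  then have F_eq: "F = density lborel (\<lambda>x. ennreal (f' x))"
    unfolding assms(8) by (intro density_cong) auto
  have "\<exists>\<alpha> k \<beta>. \<forall>x>0. f' x = exp (\<alpha> + k * ln x + \<beta> * x)"
  proof (rule gamma_if_indep[OF _ assms(11,2,3) _ f' _ _ _ ind])
    show "n \<ge> 2" using assms(1) by simp
    show "distr M borel (X i) = density lborel (\<lambda>x. ennreal (f' x))" if "i \<in> {1..n}" for i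
      using assms(4)[OF that] F_eq by simp
    show "f' x = 0" if "x \<le> 0" for x using that by (simp add: f'_def)
    show "f' x > 0" if "x > 0" for x using that assms(10) by (simp add: f'_def)
    show "continuous_on {0<..} f'"
      using assms(9) by (rule continuous_on_eq) (simp add: f'_def)
  qed
  then obtain \<alpha> k \<beta> where kernel: "\<forall>x>0. f' x = exp (\<alpha> + k * ln x + \<beta> * x)" by blast
  have "(\<integral>\<^sup>+x. ennreal (exp (\<alpha> + k * ln x + \<beta> * x)) * indicator {0<..} x \<partial>lborel) = (\<integral>\<^sup>+x. ennreal (f' x) \<partial>lborel)"
    using kernel by (intro nn_integral_cong) (auto simp: indicator_def f'_def)
  also have "\<dots> = emeasure F (space F)"
    unfolding F_eq by (subst emeasure_density) auto
  also have "\<dots> = 1" by (rule prob_space.emeasure_space_1[OF F])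
  finally obtain a b where ab: "a > 0" "b > 0"
    and gam: "\<forall>x>0. exp (\<alpha> + k * ln x + \<beta> * x) = gamma_density a b x"
    using gamma_density_if_gamma_kernel[of \<alpha> k \<beta>] by metis
  have "f' = gamma_density a b"
    using gam kernel by (auto simp: fun_eq_iff f'_def gamma_density_def)
  then show "gamma_distribution F"
    using ab F_eq by (auto simp: gamma_distribution_def)
qed

end
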